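(* Let $m\ge 3$. The submodule $W$ of the Clifford algebra is invariant under right multiplication by $\psi(y(m))$, and the action of $\psi(y(m))$ on $W$ with respect to the ordered basis $X_m$ is as given by Sidki: for each generator $g\in\{a,s_1,\dots,s_{m-1}\}$ of $y(m)$, the matrix of right multiplication by $\psi(g)$ on $W$ with respect to $X_m$ is $g^{(m)}=\eta_m(g)$.
   Context: Groups: $x^y=y^{-1}xy$, $[x,y]=x^{-1}y^{-1}xy$; $S_m$ is the symmetric group on $\{1,\dots,m\}$, $s_i=(i,i+1)$; $y(m)=\langle a, S_m \mid [s_1,s_1^{a^k}]=1\ (k\in\mathbb{Z}),\ a^{s_i}=a^{-1}\ (2\le i\le m-1)\rangle$. Ring and form: let $s$ be an indeterminate over $\mathbb{F}_2$, $t=s^2$, and let $R$ be the ring obtained from $\mathbb{F}_2[s,s^{-1}]$ by adjoining the roots $\alpha,\alpha^{-1}$ of $x^2+sx+1$ (so $s=\alpha+\alpha^{-1}$). $V$ is the free $R$-module with basis $u,v_1,\dots,v_m$, with alternating bilinear form $(u,v_i)=(v_i,v_j)=1$ for all $i$ and all $j\ne i$, and $q$ is the quadratic form with this associated bilinear form and $q(u)=1$, $q(v_i)=t^{-1}$. $Cl=Cl(V,q)$ is its Clifford algebra (generated by $V$ with relations $w^2=q(w)$, $w\in V$). The homomorphism $\psi: y(m)\to Cl^\times$ is given by $\psi(a)=s\,uv_1$, $\psi(s_i)=u(v_i+v_{i+1})$. Elements of $y(m)$ act on $Cl$ by right multiplication: for $x\in Cl$, $g\in y(m)$ write $xg:=x\psi(g)$.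 Let $w=\frac{\alpha^2}{s}+\alpha uv_1+\alpha^{-1}uv_2+s\,v_1v_2\in Cl$. The ordered set $X_m$, of size $2^{m-2}$, is built as follows: start with the list $(w)$; for $k=1,2,\dots,m-2$ successively, append to the current list the elements $x s_{m-k}$ for each $x$ in the current list, in order. So $X_m=(w,\,ws_{m-1},\,ws_{m-2},\,ws_{m-1}s_{m-2},\dots,\,ws_{m-1}\cdots s_2)$. $W$ is the $R$-submodule of $Cl$ spanned by $X_m$ ($X_m$ is linearly independent). Matrices act on row vectors: the rows of the matrix of $g$ are the coordinates of the images of the basis elements. Sidki's matrices are defined recursively. For $m=3$: \[ a^{(3)}=\begin{pmatrix}\alpha&0\\0&\alpha^{-1}\end{pmatrix},\quad s_1^{(3)}=\begin{pmatrix}1&0\\1&1\end{pmatrix},\quad s_2^{(3)}=\begin{pmatrix}0&1\\1&0\end{pmatrix}. \] For $m\ge4$, with $m'=2^{m-3}$ and $I=I_{m'}$ the $m'\times m'$ identity matrix: \[ a^{(m)}=\begin{pmatrix}a^{(m-1)}&0\\0&(a^{(m-1)})^{-1}\end{pmatrix},\ s_1^{(m)}=\begin{pmatrix}I&0\\ I&I\end{pmatrix},\ s_2^{(m)}=\begin{pmatrix}0&I\\ I&0\end{pmatrix},\ s_3^{(m)}=\begin{pmatrix}s_2^{(m-1)}&0\\ I&s_2^{(m-1)}\end{pmatrix}, \] and $s_k^{(m)}=\begin{pmatrix}s_{k-1}^{(m-1)}&0\\0&s_{k-1}^{(m-1)}\end{pmatrix}$ for $4\le k\le m-1$. The representation $\eta_m$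 sends $a\mapsto a^{(m)}$, $s_k\mapsto s_k^{(m)}$. *)

theory Defs
  imports
    "HOL-Library.Z2"
    "HOL-Library.Poly_Mapping"
    "HOL-Computational_Algebra.Polynomial"
    "HOL-Combinatorics.Transposition"
    "HOL-Algebra.QuotRing"
    "HOL-Algebra.Sym_Groups"
    "Jordan_Normal_Form.Matrix"
begin

section \<open>The coefficient ring\<close>

text \<open>\<^typ>\<open>int \<Rightarrow>\<^sub>0 bit\<close> with convolution product is the ring of Laurent polynomials over the
  field with two elements.\<close>

type_synonym laurent2 = "int \<Rightarrow>\<^sub>0 bit"

definition lau_s :: laurent2 where "lau_s = Poly_Mapping.single 1 1"
definition lau_sinv :: laurent2 where "lau_sinv = Poly_Mapping.single (- 1) 1"

definition adj_poly :: "laurent2 poly" where "adj_poly = [:1, lau_s, 1:]"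

lemma adj_poly_dvd_const: "adj_poly dvd [:c:] \<longleftrightarrow> c = 0"
proof
  assume "adj_poly dvd [:c:]"
  then show "c = 0"
    using dvd_imp_degree_le[of adj_poly "[:c:]"] by (auto simp: adj_poly_def)
qed simp

quotient_type coeff_ring = "laurent2 poly" / "\<lambda>p q. adj_poly dvd (p - q)"
proof (rule equivpI)
  show "reflp (\<lambda>p q. adj_poly dvd (p - q))" by (simp add: reflp_def)
  show "symp (\<lambda>p q. adj_poly dvd (p - q))"
    by (rule sympI) (subst minus_diff_eq [symmetric], subst dvd_minus_iff, assumption)
  show "transp (\<lambda>p q. adj_poly dvd (p - q))"
  proof (rule transpI)
    fix p q r assume "adj_poly dvd p - q" "adj_poly dvd q - r"
    then have "adj_poly dvd (p - q) + (q - r)" by (rule dvd_add)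
    then show "adj_poly dvd p - r" by simp
  qed
qed

instantiation coeff_ring :: comm_ring_1
begin

lift_definition zero_coeff_ring :: coeff_ring is 0 .
lift_definition one_coeff_ring :: coeff_ring is 1 .
lift_definition plus_coeff_ring :: "coeff_ring \<Rightarrow> coeff_ring \<Rightarrow> coeff_ring" is "(+)"
proof -
  fix p p' q q' :: "laurent2 poly"
  assume "adj_poly dvd p - p'" "adj_poly dvd q - q'"
  then have "adj_poly dvd (p - p') + (q - q')" by (rule dvd_add)
  then show "adj_poly dvd p + q - (p' + q')" by (simp add: add_diff_add)
qed
lift_definition minus_coeff_ring :: "coeff_ring \<Rightarrow> coeff_ring \<Rightarrow> coeff_ring" is "(-)"
proof -
  fix p p' q q' :: "laurent2 poly"
  assume "adj_poly dvd p - p'" "adj_poly dvd q - q'"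
  then have "adj_poly dvd (p - p') - (q - q')" by (rule dvd_diff)
  then show "adj_poly dvd p - q - (p' - q')" by (simp add: algebra_simps)
qed
lift_definition uminus_coeff_ring :: "coeff_ring \<Rightarrow> coeff_ring" is "uminus"
  by (simp only: minus_diff_minus dvd_minus_iff)
lift_definition times_coeff_ring :: "coeff_ring \<Rightarrow> coeff_ring \<Rightarrow> coeff_ring" is "(*)"
proof -
  fix p p' q q' :: "laurent2 poly"
  assume "adj_poly dvd p - p'" "adj_poly dvd q - q'"
  then have "adj_poly dvd (p - p') * q + p' * (q - q')" by (simp add: dvd_add)
  then show "adj_poly dvd p * q - p' * q'" by (simp add: algebra_simps)
qed

instance
proof
  have "\<not> adj_poly dvd 1"
    using adj_poly_dvd_const[of 1] by (simp add: one_pCons)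
  then show "(0 :: coeff_ring) \<noteq> 1"
    by transfer simp
  have eq: "p = q \<Longrightarrow> adj_poly dvd p - q" for p q by simp
  fix a b c :: coeff_ring
  show "a * b * c = a * (b * c)" by transfer (rule eq, rule mult.assoc)
  show "a * b = b * a" by transfer (rule eq, rule mult.commute)
  show "1 * a = a" by transfer (rule eq, rule mult_1_left)
  show "(a + b) * c = a * c + b * c" by transfer (rule eq, rule distrib_right)
  show "a + b + c = a + (b + c)" by transfer (rule eq, rule add.assoc)
  show "a + b = b + a" by transfer (rule eq, rule add.commute)
  show "0 + a = a" by transfer (rule eq, rule add_0_left)
  show "- a + a = 0" by transfer (rule eq, rule left_minus)
  show "a - b = a + - b" by transfer (rule eq, rule diff_conv_add_uminus)
qed

end

definition cr_of_laurent :: "laurent2 \<Rightarrow> coeff_ring" where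
  "cr_of_laurent c = abs_coeff_ring [:c:]"

definition cr_alpha :: coeff_ring where
  "cr_alpha = abs_coeff_ring [:0, 1:]"

definition cr_s :: coeff_ring where "cr_s = cr_of_laurent lau_s"
definition cr_sinv :: coeff_ring where "cr_sinv = cr_of_laurent lau_sinv"

text \<open>The second root of \<open>x\<^sup>2 + s x + 1\<close>.\<close>

definition cr_alphainv :: coeff_ring where "cr_alphainv = cr_s + cr_alpha"

lemma bit_add_self: "(x :: bit) + x = 0"
  by (cases x) simp_all

lemma laurent2_add_self: "(c :: laurent2) + c = 0"
  by (rule poly_mapping_eqI) (simp only: lookup_add bit_add_self lookup_zero)

lemma cr_add_self: "(x :: coeff_ring) + x = 0"
proof transfer
  fix p :: "laurent2 poly"
  have "p + p = 0" by (rule poly_eqI) (simp only: coeff_add laurent2_add_self coeff_0)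
  then show "adj_poly dvd p + p - 0" by (simp only: diff_zero dvd_0_right)
qed

lemma cr_minus_eq: "- (x :: coeff_ring) = x"
  using cr_add_self[of x] by (simp add: minus_unique)

lemma cr_s_inverse: "cr_s * cr_sinv = 1"
proof -
  have "lau_sinv * lau_s = 1" by (simp add: lau_s_def lau_sinv_def mult_single)
  then show ?thesis
    by (simp add: cr_s_def cr_sinv_def cr_of_laurent_def times_coeff_ring.abs_eq
        one_coeff_ring_def one_pCons)
qed

lemma cr_alpha_root: "cr_alpha\<^sup>2 + cr_s * cr_alpha + 1 = 0"
  by (simp add: cr_s_def cr_alpha_def cr_of_laurent_def power2_eq_square times_coeff_ring.abs_eq
      plus_coeff_ring.abs_eq one_coeff_ring_def zero_coeff_ring_def coeff_ring.abs_eq_iff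
      one_pCons adj_poly_def)

lemma cr_alpha_inverse: "cr_alpha * cr_alphainv = 1"
proof -
  have "cr_alpha * cr_alphainv + 1 = 0"
    using cr_alpha_root by (simp add: cr_alphainv_def algebra_simps power2_eq_square)
  then show ?thesis by (metis add_eq_0_iff2 cr_minus_eq)
qed

lemma cr_s_eq: "cr_s = cr_alpha + cr_alphainv"
proof -
  have "cr_alpha + cr_alphainv = cr_s + (cr_alpha + cr_alpha)"
    by (simp add: cr_alphainv_def algebra_simps)
  then show ?thesis by (simp add: cr_add_self)
qed

lemma cr_of_laurent_inject: "cr_of_laurent c = cr_of_laurent d \<longleftrightarrow> c = d"
  using adj_poly_dvd_const[of "c - d"]
  by (simp add: cr_of_laurent_def coeff_ring.abs_eq_iff)


section \<open>The quadratic module\<close>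

text \<open>Vectors are given by their coordinates in the basis \<open>u, v\<^sub>1, \<dots>, v\<^sub>m\<close>: index \<open>0\<close> belongs
  to \<open>u\<close>, and index \<open>i \<ge> 1\<close> to \<open>v\<^sub>i\<close>.\<close>

definition Vmod :: "nat \<Rightarrow> (nat \<Rightarrow> coeff_ring) set" where
  "Vmod m = {x. \<forall>i > m. x i = 0}"

definition basis_vec :: "nat \<Rightarrow> nat \<Rightarrow> coeff_ring" where
  "basis_vec i = (\<lambda>j. if j = i then 1 else 0)"

definition bform :: "nat \<Rightarrow> (nat \<Rightarrow> coeff_ring) \<Rightarrow> (nat \<Rightarrow> coeff_ring) \<Rightarrow> coeff_ring" where
  "bform m x y = (\<Sum>i\<le>m. \<Sum>j\<le>m. x i * y j * (if i = j then 0 else 1))"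

text \<open>The coefficient of \<open>x\<^sub>i x\<^sub>j\<close> (\<open>i < j\<close>) is the value \<open>1\<close> of the bilinear form on two
  distinct basis vectors; the coefficient of \<open>x\<^sub>i\<^sup>2\<close> is the value of \<open>q\<close> on a basis vector.\<close>

definition qform :: "nat \<Rightarrow> (nat \<Rightarrow> coeff_ring) \<Rightarrow> coeff_ring" where
  "qform m x = (\<Sum>i\<le>m. (x i)\<^sup>2 * (if i = 0 then 1 else cr_sinv\<^sup>2)) + (\<Sum>j\<le>m. \<Sum>i<j. x i * x j)"

lemma qform_scale: "qform m (\<lambda>i. c * x i) = c\<^sup>2 * qform m x"
proof -
  have "c * a * (c * b) = c\<^sup>2 * (a * b)" for a b
    by (simp add: power2_eq_square ac_simps)
  then show ?thesis
    by (simp only: qform_def sum_distrib_left power_mult_distrib distrib_left mult.assoc)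
qed

lemma qform_polar: "qform m (\<lambda>i. x i + y i) = qform m x + qform m y + bform m x y"
proof -
  have sq: "(a + b)\<^sup>2 = a\<^sup>2 + b\<^sup>2" for a b :: coeff_ring
  proof -
    have "(a + b)\<^sup>2 = a\<^sup>2 + b\<^sup>2 + (a * b + a * b)"
      by (simp add: power2_eq_square algebra_simps)
    then show ?thesis by (simp only: cr_add_self add_0_right)
  qed
  have D: "(\<Sum>i\<le>m. (x i + y i)\<^sup>2 * d i) = (\<Sum>i\<le>m. (x i)\<^sup>2 * d i) + (\<Sum>i\<le>m. (y i)\<^sup>2 * d i)" for d
    by (simp add: sq distrib_right sum.distrib)
  have "(\<Sum>j\<le>m. \<Sum>i<j. (x i + y i) * (x j + y j)) =
      (\<Sum>j\<le>m. \<Sum>i<j. x i * x j) + (\<Sum>j\<le>m. \<Sum>i<j. y i * y j) + bform m x y"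
  proof (induction m)
    case 0
    then show ?case by (simp add: bform_def)
  next
    case (Suc m)
    have "bform (Suc m) x y = bform m x y
        + (\<Sum>i\<le>m. x i * y (Suc m)) + (\<Sum>j\<le>m. x (Suc m) * y j)"
      by (simp add: bform_def sum.distrib add_ac)
    with Suc show ?case
      by (simp add: lessThan_Suc_atMost sum.distrib distrib_left distrib_right
          sum_distrib_left sum_distrib_right add_ac mult_ac)
  qed
  then show ?thesis unfolding qform_def D by (simp only: add_ac)
qed

lemma bform_basis:
  assumes "i \<le> m" "j \<le> m"
  shows "bform m (basis_vec i) (basis_vec j) = (if i = j then 0 else 1)"
proof -
  have "bform m (basis_vec i) (basis_vec j) =
      (\<Sum>a\<le>m. if a = i then (\<Sum>b\<le>m. if b = j then (if a = b then 0 else 1) else 0) else 0)"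
    unfolding bform_def
  proof (rule sum.cong [OF refl])
    fix a
    have "(\<Sum>b\<le>m. basis_vec i a * basis_vec j b * (if a = b then 0 else 1)) =
        basis_vec i a * (\<Sum>b\<le>m. basis_vec j b * (if a = b then 0 else 1))"
      by (simp add: sum_distrib_left mult.assoc)
    also have "(\<Sum>b\<le>m. basis_vec j b * (if a = b then 0 else 1)) =
        (\<Sum>b\<le>m. if b = j then (if a = b then 0 else 1) else 0)"
      by (intro sum.cong refl) (simp add: basis_vec_def)
    finally show "(\<Sum>b\<le>m. basis_vec i a * basis_vec j b * (if a = b then 0 else 1)) =
        (if a = i then \<Sum>b\<le>m. if b = j then if a = b then 0 else 1 else 0 else 0)"
      by (simp add: basis_vec_def)
  qed
  then show ?thesis using assms by (simp add: sum.delta)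
qed

lemma qform_basis:
  assumes "i \<le> m"
  shows "qform m (basis_vec i) = (if i = 0 then 1 else cr_sinv\<^sup>2)"
proof -
  have "(\<Sum>b\<le>m. \<Sum>a<b. basis_vec i a * basis_vec i b) = 0"
    by (intro sum.neutral ballI) (auto simp: basis_vec_def)
  moreover have "(\<Sum>a\<le>m. (basis_vec i a)\<^sup>2 * (if a = 0 then 1 else cr_sinv\<^sup>2)) =
      (\<Sum>a\<le>m. if a = i then (if a = 0 then 1 else cr_sinv\<^sup>2) else 0)"
    by (intro sum.cong refl) (auto simp: basis_vec_def)
  ultimately show ?thesis using assms by (simp add: qform_def sum.delta)
qed


section \<open>The Clifford algebra\<close>

text \<open>The tensor algebra of \<open>V\<close> is realised as the free associative algebra on the basis, that is,
  the monoid algebra of the free monoid of lists over the indices \<open>0, \<dots>, m\<close>. The datatype wrapper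
  is needed since addition on an exponent type has to be concatenation.\<close>

datatype nc_word = NCWord (letters: "nat list")

instantiation nc_word :: monoid_add
begin
definition zero_nc_word :: nc_word where "0 = NCWord []"
definition plus_nc_word :: "nc_word \<Rightarrow> nc_word \<Rightarrow> nc_word" where
  "x + y = NCWord (letters x @ letters y)"
instance by standard (simp_all add: zero_nc_word_def plus_nc_word_def)
end

type_synonym tensor = "nc_word \<Rightarrow>\<^sub>0 coeff_ring"

definition tscal :: "coeff_ring \<Rightarrow> tensor" where
  "tscal c = Poly_Mapping.single 0 c"

definition tgen :: "nat \<Rightarrow> tensor" where
  "tgen i = Poly_Mapping.single (NCWord [i]) 1"

abbreviation t_u :: tensor where "t_u \<equiv> tgen 0"
abbreviation t_v :: "nat \<Rightarrow> tensor" where "t_v i \<equiv> tgen i"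

definition tvec :: "nat \<Rightarrow> (nat \<Rightarrow> coeff_ring) \<Rightarrow> tensor" where
  "tvec m x = (\<Sum>i\<le>m. tscal (x i) * tgen i)"

definition tensor_alg :: "nat \<Rightarrow> tensor ring" where
  "tensor_alg m =
    \<lparr>carrier = {p. \<forall>w \<in> Poly_Mapping.keys p. set (letters w) \<subseteq> {0..m}},
     monoid.mult = (*), one = 1, zero = 0, add = (+)\<rparr>"

lemma ring_tensor_alg: "ring (tensor_alg m)"
proof (rule ringI)
  let ?T = "tensor_alg m"
  have carr: "p \<in> carrier ?T \<longleftrightarrow> (\<forall>w \<in> Poly_Mapping.keys p. set (letters w) \<subseteq> {0..m})" for p
    by (simp add: tensor_alg_def)
  have ops: "p \<otimes>\<^bsub>?T\<^esub> q = p * q" "p \<oplus>\<^bsub>?T\<^esub> q = p + q" "\<one>\<^bsub>?T\<^esub> = 1" "\<zero>\<^bsub>?T\<^esub> = 0" for p q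
    by (simp_all add: tensor_alg_def)
  show "abelian_group ?T"
  proof (rule abelian_groupI)
    fix p q assume "p \<in> carrier ?T" "q \<in> carrier ?T"
    then show "p \<oplus>\<^bsub>?T\<^esub> q \<in> carrier ?T"
      unfolding carr ops using keys_add[of p q] by blast
  next
    fix p assume "p \<in> carrier ?T"
    then show "\<exists>q \<in> carrier ?T. q \<oplus>\<^bsub>?T\<^esub> p = \<zero>\<^bsub>?T\<^esub>"
      unfolding ops by (intro bexI[of _ "- p"]) (simp_all add: carr)
  qed (simp_all add: carr ops add_ac)
  show "monoid ?T"
  proof (rule monoidI)
    fix p q assume *: "p \<in> carrier ?T" "q \<in> carrier ?T"
    have "set (letters w) \<subseteq> {0..m}" if "w \<in> Poly_Mapping.keys (p * q)" for w
    proof -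
      from that keys_mult[of p q] obtain a b where
        w: "w = a + b" "a \<in> Poly_Mapping.keys p" "b \<in> Poly_Mapping.keys q" by blast
      with * have "set (letters a) \<subseteq> {0..m}" "set (letters b) \<subseteq> {0..m}"
        unfolding carr by blast+
      then show ?thesis by (simp add: w(1) plus_nc_word_def)
    qed
    then show "p \<otimes>\<^bsub>?T\<^esub> q \<in> carrier ?T" by (simp add: carr ops)
  qed (simp_all add: carr ops mult.assoc zero_nc_word_def)
qed (simp_all add: tensor_alg_def distrib_left distrib_right)

definition cliff_ideal :: "nat \<Rightarrow> tensor set" where
  "cliff_ideal m =
    genideal (tensor_alg m) {tvec m x * tvec m x - tscal (qform m x) | x. x \<in> Vmod m}"

type_synonym cliff = "tensor set"

definition Cl :: "nat \<Rightarrow> cliff ring" where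
  "Cl m = tensor_alg m Quot cliff_ideal m"

definition cl_of :: "nat \<Rightarrow> tensor \<Rightarrow> cliff" where
  "cl_of m p = cliff_ideal m +>\<^bsub>tensor_alg m\<^esub> p"

definition cl_smult :: "nat \<Rightarrow> coeff_ring \<Rightarrow> cliff \<Rightarrow> cliff" where
  "cl_smult m c x = cl_of m (tscal c) \<otimes>\<^bsub>Cl m\<^esub> x"

definition cl_lincomb :: "nat \<Rightarrow> (nat \<Rightarrow> coeff_ring) \<Rightarrow> cliff list \<Rightarrow> cliff" where
  "cl_lincomb m c xs = (\<Oplus>\<^bsub>Cl m\<^esub> i \<in> {..<length xs}. cl_smult m (c i) (xs ! i))"

definition cl_span :: "nat \<Rightarrow> cliff list \<Rightarrow> cliff set" where
  "cl_span m xs = {cl_lincomb m c xs | c. True}"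

definition cl_lin_indep :: "nat \<Rightarrow> cliff list \<Rightarrow> bool" where
  "cl_lin_indep m xs \<longleftrightarrow>
    (\<forall>c. cl_lincomb m c xs = \<zero>\<^bsub>Cl m\<^esub> \<longrightarrow> (\<forall>i < length xs. c i = 0))"

text \<open>Row convention: row \<open>i\<close> of the matrix holds the coordinates of the image of the \<open>i\<close>-th
  basis element.\<close>

definition is_matrix_wrt :: "nat \<Rightarrow> cliff list \<Rightarrow> (cliff \<Rightarrow> cliff) \<Rightarrow> coeff_ring mat \<Rightarrow> bool" where
  "is_matrix_wrt m xs f M \<longleftrightarrow>
    M \<in> carrier_mat (length xs) (length xs) \<and>
    (\<forall>i < length xs. f (xs ! i) = cl_lincomb m (\<lambda>j. M $$ (i, j)) xs)"


section \<open>Groups given by generators and relations\<close>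

text \<open>A letter \<open>(True, x)\<close> stands for the generator \<open>x\<close>, and \<open>(False, x)\<close> for its inverse. A
  relation \<open>l = r\<close> is a pair of words.\<close>

type_synonym 'g gword = "(bool \<times> 'g) list"

definition gwords :: "'g set \<Rightarrow> 'g gword set" where
  "gwords X = lists (UNIV \<times> X)"

definition gw_inv :: "'g gword \<Rightarrow> 'g gword" where
  "gw_inv w = rev (map (\<lambda>(b, x). (\<not> b, x)) w)"

definition gw_pow :: "'g gword \<Rightarrow> int \<Rightarrow> 'g gword" where
  "gw_pow w k = concat (replicate (nat \<bar>k\<bar>) (if k \<ge> 0 then w else gw_inv w))"

definition gw_conj :: "'g gword \<Rightarrow> 'g gword \<Rightarrow> 'g gword" where
  "gw_conj x y = gw_inv y @ x @ y"

definition gw_comm :: "'g gword \<Rightarrow> 'g gword \<Rightarrow> 'g gword" where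
  "gw_comm x y = gw_inv x @ gw_inv y @ x @ y"

inductive pres_eq :: "'g set \<Rightarrow> ('g gword \<times> 'g gword) set \<Rightarrow> 'g gword \<Rightarrow> 'g gword \<Rightarrow> bool"
  for X and Rel where
  refl: "pres_eq X Rel v v"
| sym: "pres_eq X Rel v w \<Longrightarrow> pres_eq X Rel w v"
| trans: "pres_eq X Rel v w \<Longrightarrow> pres_eq X Rel w z \<Longrightarrow> pres_eq X Rel v z"
| cancel: "x \<in> X \<Longrightarrow> pres_eq X Rel (v @ [(b, x), (\<not> b, x)] @ w) (v @ w)"
| rel: "(l, r) \<in> Rel \<Longrightarrow> pres_eq X Rel (v @ l @ w) (v @ r @ w)"

definition pres_class :: "'g set \<Rightarrow> ('g gword \<times> 'g gword) set \<Rightarrow> 'g gword \<Rightarrow> 'g gword set" where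
  "pres_class X Rel w = {v \<in> gwords X. pres_eq X Rel w v}"

definition pres_group :: "'g set \<Rightarrow> ('g gword \<times> 'g gword) set \<Rightarrow> 'g gword set monoid" where
  "pres_group X Rel =
    \<lparr>carrier = pres_class X Rel ` gwords X,
     monoid.mult = (\<lambda>A B. \<Union>v \<in> A. \<Union>w \<in> B. pres_class X Rel (v @ w)),
     one = pres_class X Rel []\<rparr>"


section \<open>The group \<open>y(m)\<close>\<close>

text \<open>The symmetric group enters the presentation through all its elements and its multiplication
  table. The library composes permutations from right to left; inversion identifies this group with
  the one using the opposite product and fixes each \<open>s\<^sub>i\<close>, so the convention does not
  affect the presented group together with its elements \<open>a\<close>, \<open>s\<^sub>i\<close>.\<close>

datatype y_gen = Gen_a | Gen_perm "nat \<Rightarrow> nat"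

definition adj_transp :: "nat \<Rightarrow> nat \<Rightarrow> nat" where
  "adj_transp i = transpose i (Suc i)"

definition gw_a :: "y_gen gword" where "gw_a = [(True, Gen_a)]"
definition gw_perm :: "(nat \<Rightarrow> nat) \<Rightarrow> y_gen gword" where "gw_perm p = [(True, Gen_perm p)]"
definition gw_s :: "nat \<Rightarrow> y_gen gword" where "gw_s i = gw_perm (adj_transp i)"

definition y_gens :: "nat \<Rightarrow> y_gen set" where
  "y_gens m = {Gen_a} \<union> Gen_perm ` carrier (sym_group m)"

definition y_rels :: "nat \<Rightarrow> (y_gen gword \<times> y_gen gword) set" where
  "y_rels m =
    {(gw_perm p @ gw_perm p', gw_perm (p \<otimes>\<^bsub>sym_group m\<^esub> p')) | p p'.
        p \<in> carrier (sym_group m) \<and> p' \<in> carrier (sym_group m)}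
    \<union> {(gw_comm (gw_s 1) (gw_conj (gw_s 1) (gw_pow gw_a k)), []) | k. True}
    \<union> {(gw_conj gw_a (gw_s i), gw_inv gw_a) | i. 2 \<le> i \<and> i \<le> m - 1}"

definition y_group :: "nat \<Rightarrow> y_gen gword set monoid" where
  "y_group m = pres_group (y_gens m) (y_rels m)"

definition y_a :: "nat \<Rightarrow> y_gen gword set" where
  "y_a m = pres_class (y_gens m) (y_rels m) gw_a"

definition y_s :: "nat \<Rightarrow> nat \<Rightarrow> y_gen gword set" where
  "y_s m i = pres_class (y_gens m) (y_rels m) (gw_s i)"


section \<open>The action on the Clifford algebra\<close>

definition is_psi :: "nat \<Rightarrow> (y_gen gword set \<Rightarrow> cliff) \<Rightarrow> bool" where
  "is_psi m \<psi> \<longleftrightarrow>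
    \<psi> \<in> hom (y_group m) (units_of (Cl m)) \<and>
    \<psi> (y_a m) = cl_of m (tscal cr_s * t_u * t_v 1) \<and>
    (\<forall>i \<in> {1..m-1}. \<psi> (y_s m i) = cl_of m (t_u * (t_v i + t_v (i + 1))))"

definition cl_act :: "nat \<Rightarrow> (y_gen gword set \<Rightarrow> cliff) \<Rightarrow> y_gen gword set \<Rightarrow> cliff \<Rightarrow> cliff" where
  "cl_act m \<psi> g x = x \<otimes>\<^bsub>Cl m\<^esub> \<psi> g"

definition cl_w :: "nat \<Rightarrow> cliff" where
  "cl_w m = cl_of m (tscal (cr_alpha\<^sup>2 * cr_sinv) + tscal cr_alpha * t_u * t_v 1
     + tscal cr_alphainv * t_u * t_v 2 + tscal cr_s * t_v 1 * t_v 2)"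

definition X_list :: "nat \<Rightarrow> (y_gen gword set \<Rightarrow> cliff) \<Rightarrow> cliff list" where
  "X_list m \<psi> = foldl (\<lambda>xs k. xs @ map (cl_act m \<psi> (y_s m (m - k))) xs) [cl_w m] [1..<m-1]"

definition W_mod :: "nat \<Rightarrow> (y_gen gword set \<Rightarrow> cliff) \<Rightarrow> cliff set" where
  "W_mod m \<psi> = cl_span m (X_list m \<psi>)"


section \<open>Sidki's matrices\<close>

text \<open>The values for \<open>m < 3\<close> are irrelevant.\<close>

fun sidki_a :: "nat \<Rightarrow> coeff_ring mat" where
  "sidki_a m =
    (if m \<le> 3 then mat_of_rows_list 2 [[cr_alpha, 0], [0, cr_alphainv]]
     else let n = 2 ^ (m - 3); A = sidki_a (m - 1) in
       four_block_mat A (0\<^sub>m n n) (0\<^sub>m n n) (inv\<^bsub>ring_mat TYPE(coeff_ring) n ()\<^esub> A))"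

declare sidki_a.simps [simp del]

fun sidki_s :: "nat \<Rightarrow> nat \<Rightarrow> coeff_ring mat" where
  "sidki_s m k =
    (if m \<le> 3 then
       (if k = 1 then mat_of_rows_list 2 [[1, 0], [1, 1]] else mat_of_rows_list 2 [[0, 1], [1, 0]])
     else let n = 2 ^ (m - 3) in
       if k = 1 then four_block_mat (1\<^sub>m n) (0\<^sub>m n n) (1\<^sub>m n) (1\<^sub>m n)
       else if k = 2 then four_block_mat (0\<^sub>m n n) (1\<^sub>m n) (1\<^sub>m n) (0\<^sub>m n n)
       else if k = 3 then
         four_block_mat (sidki_s (m - 1) 2) (0\<^sub>m n n) (1\<^sub>m n) (sidki_s (m - 1) 2)
       else four_block_mat (sidki_s (m - 1) (k - 1)) (0\<^sub>m n n) (0\<^sub>m n n) (sidki_s (m - 1) (k - 1)))"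

declare sidki_s.simps [simp del]

end

theory Submission
  imports Defs "HOL-Library.Function_Algebras"
begin

text \<open>
  Write \<open>\<sigma>\<^sub>j = u (v\<^sub>j + v\<^sub>j\<^sub>+\<^sub>1)\<close> for the image of \<open>s\<^sub>j\<close>. The vectors \<open>v\<^sub>j + v\<^sub>j\<^sub>+\<^sub>1\<close> are orthogonal to
  \<open>u\<close>, have norm \<open>1\<close>, and pair to \<open>1\<close> exactly with their neighbours. Hence \<open>\<sigma>\<^sub>j\<^sup>2 = 1\<close>, distant \<open>\<sigma>\<close>s
  commute, and neighbours satisfy \<open>\<sigma>\<^sub>i \<sigma>\<^sub>j + \<sigma>\<^sub>j \<sigma>\<^sub>i = 1\<close> (\<open>sig_square\<close>, \<open>sig_commute\<close>,
  \<open>sig_braid\<close>); moreover \<open>\<sigma>\<^sub>j\<close> conjugates the image of \<open>a\<close> to its inverse for \<open>j \<ge> 2\<close> (\<open>sig_a\<close>).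
  The element \<open>w\<close> is a product of two factors that make it a common eigenvector of \<open>u v\<^sub>1\<close> and
  \<open>u v\<^sub>2\<close>; so \<open>w a = \<alpha> w\<close> and \<open>w s\<^sub>1 = w\<close> (\<open>w_mult_a\<close>, \<open>w_mult_sig1\<close>).

  From these facts alone the matrices follow. The list \<open>X\<^sub>m\<close> is produced by repeatedly doubling a
  list \<open>Y\<close> to \<open>Y, Y \<sigma>\<close>. A generator \<open>g\<close> with \<open>\<sigma> g = g' \<sigma>\<close> acts on the doubled list by a block
  diagonal matrix, one with \<open>\<sigma> g = g \<sigma> + 1\<close> acquires an identity block below the diagonal, and
  \<open>\<sigma>\<close> itself swaps the halves. These are the three shapes in Sidki's recursion, and the induction
  over the number of doublings is \<open>sig_acts\<close>, \<open>sig1_acts\<close> and \<open>a_acts\<close>. Invariance of \<open>W\<close> under all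
  of \<open>y(m)\<close> follows, since the image of \<open>a\<close> has inverse \<open>a + s\<close> and the symmetric group is
  generated by the \<open>s\<^sub>j\<close>.

  For linear independence some nonzero module over the Clifford algebra is needed. The algebra acts
  on a Fock space of coefficient functions on sets of indices, where a basis vector acts by
  raising plus a contraction; in characteristic two no signs occur. The contraction with the
  linear form that is \<open>1\<close> on \<open>v\<^sub>k\<close> for \<open>k > j\<close> and \<open>0\<close> on the other basis vectors commutes with
  \<open>\<sigma>\<^sub>i\<close> for \<open>i \<noteq> j\<close>, kills the image of the vacuum under \<open>w\<close> if \<open>j \<ge> 2\<close>, and its commutator with
  \<open>\<sigma>\<^sub>j\<close> is \<open>u\<close>. Applied to a relation
  \<open>x + x' \<sigma>\<^sub>j = 0\<close> between the two halves of a doubled list, it leaves \<open>x' u = 0\<close>, thus \<open>x' = 0\<close>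
  (\<open>t_list_independent\<close>); what remains in the end is a multiple of \<open>w\<close>, which has the unit \<open>\<alpha>\<close> as a
  coefficient.\<close>

section \<open>Congruences modulo the Clifford relations\<close>

lemma cr_alphainv_inverse: "cr_alphainv * cr_alpha = 1"
  using cr_alpha_inverse by (simp add: mult.commute)

lemma tscal_simps:
  "tscal (a + b) = tscal a + tscal b" "tscal (a * b) = tscal a * tscal b"
  "tscal 0 = 0" "tscal 1 = 1"
  by (simp_all add: tscal_def single_add mult_single)

lemma tscal_single_commute: "Poly_Mapping.single w d * tscal c = tscal c * Poly_Mapping.single w d"
  by (simp add: tscal_def mult_single mult.commute)

lemma tensor_induct [case_names single add]:
  assumes "\<And>w c. P (Poly_Mapping.single w c)" and "\<And>p q. P p \<Longrightarrow> P q \<Longrightarrow> P (p + q)"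
  shows "P (p :: tensor)"
proof (induction p rule: update_induct)
  case const
  show ?case using assms(1)[of 0 0] by simp
next
  case (update p a b)
  have "Poly_Mapping.update a b p = p + Poly_Mapping.single a b"
    using update by (intro poly_mapping_eqI)
      (auto simp: lookup_update lookup_add lookup_single when_def in_keys_iff)
  then show ?case using assms update by simp
qed

lemma tscal_central: "p * tscal c = tscal c * p"
  by (induction p rule: tensor_induct) (simp_all add: tscal_single_commute algebra_simps)

lemma tscal_left_commute: "p * (tscal c * q) = tscal c * (p * q)"
  by (metis mult.assoc tscal_central)

lemma tensor_add_self: "(p :: tensor) + p = 0"
  by (rule poly_mapping_eqI) (simp only: lookup_add cr_add_self lookup_zero)

lemma tensor_minus: "- (p :: tensor) = p"
  using tensor_add_self[of p] by (simp add: minus_unique)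

lemma tensor_diff: "(p :: tensor) - q = p + q"
  by (metis diff_conv_add_uminus tensor_minus)

lemma tensor_add_self_left: "(p :: tensor) + (p + q) = q"
  by (simp add: add.assoc[symmetric] tensor_add_self)

lemma tvec_add: "tvec m (\<lambda>i. x i + y i) = tvec m x + tvec m y"
  by (simp add: tvec_def tscal_simps distrib_right sum.distrib)

lemma tvec_basis_vec:
  assumes "i \<le> m"
  shows "tvec m (basis_vec i) = tgen i"
proof -
  have "tvec m (basis_vec i) = (\<Sum>j\<le>m. if j = i then tgen j else 0)"
    unfolding tvec_def by (intro sum.cong refl) (auto simp: basis_vec_def tscal_simps)
  then show ?thesis using assms by simp
qed

text \<open>Equations in the Clifford algebra are handled as congruences between tensors: the tensors
  form a type with the ring operations, whereas the Clifford algebra only exists as a carrier set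
  that depends on \<open>m\<close>.\<close>

locale clifford =
  fixes m :: nat
  assumes m_ge: "3 \<le> m"
begin

abbreviation T :: "tensor set" where "T \<equiv> carrier (tensor_alg m)"
abbreviation I :: "tensor set" where "I \<equiv> cliff_ideal m"

lemma tensor_ops:
  "p \<otimes>\<^bsub>tensor_alg m\<^esub> q = p * q" "p \<oplus>\<^bsub>tensor_alg m\<^esub> q = p + q"
  "\<one>\<^bsub>tensor_alg m\<^esub> = 1" "\<zero>\<^bsub>tensor_alg m\<^esub> = 0"
  by (simp_all add: tensor_alg_def)

sublocale TR: ring "tensor_alg m" by (rule ring_tensor_alg)

lemma T_0: "0 \<in> T" and T_1: "1 \<in> T"
  using TR.zero_closed TR.one_closed by (simp_all add: tensor_ops)

lemma T_add: "p \<in> T \<Longrightarrow> q \<in> T \<Longrightarrow> p + q \<in> T"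
  using TR.add.m_closed by (simp add: tensor_ops)

lemma T_mult: "p \<in> T \<Longrightarrow> q \<in> T \<Longrightarrow> p * q \<in> T"
  using TR.m_closed by (simp add: tensor_ops)

lemma T_tscal: "tscal c \<in> T"
  by (simp add: tensor_alg_def tscal_def zero_nc_word_def)

lemma T_tgen: "i \<le> m \<Longrightarrow> tgen i \<in> T"
  by (simp add: tensor_alg_def tgen_def)

lemma T_sum: "(\<And>i. i \<in> A \<Longrightarrow> f i \<in> T) \<Longrightarrow> sum f A \<in> T"
  by (induction A rule: infinite_finite_induct) (simp_all add: T_0 T_add)

lemma T_tvec: "tvec m x \<in> T"
  by (auto simp: tvec_def intro!: T_sum T_mult T_tscal T_tgen)

lemmas T_intros = T_0 T_1 T_add T_mult T_tscal T_tgen T_sum T_tvec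

lemma T_minus: "\<ominus>\<^bsub>tensor_alg m\<^esub> p = p" if "p \<in> T" for p
  using that TR.minus_equality[of p p] by (simp add: tensor_ops tensor_add_self)

sublocale CI: ideal I "tensor_alg m"
  unfolding cliff_ideal_def
  by (rule TR.genideal_ideal) (auto simp: tensor_diff intro!: T_intros)

sublocale CH: ring_hom_ring "tensor_alg m" "Cl m" "cl_of m"
  using CI.rcos_ring_hom_ring unfolding Cl_def cl_of_def by simp

lemma cl_of_add: "p \<in> T \<Longrightarrow> q \<in> T \<Longrightarrow> cl_of m (p + q) = cl_of m p \<oplus>\<^bsub>Cl m\<^esub> cl_of m q"
  using CH.hom_add by (simp add: tensor_ops)

lemma cl_of_mult: "p \<in> T \<Longrightarrow> q \<in> T \<Longrightarrow> cl_of m (p * q) = cl_of m p \<otimes>\<^bsub>Cl m\<^esub> cl_of m q"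
  using CH.hom_mult by (simp add: tensor_ops)

lemma cl_of_1: "cl_of m 1 = \<one>\<^bsub>Cl m\<^esub>"
  using CH.hom_one by (simp add: tensor_ops)

lemma cl_of_0: "cl_of m 0 = \<zero>\<^bsub>Cl m\<^esub>"
  using CH.hom_zero by (simp add: tensor_ops)

lemma cl_of_eq_iff:
  assumes "p \<in> T" "q \<in> T"
  shows "cl_of m p = cl_of m q \<longleftrightarrow> p + q \<in> I"
proof -
  have "p \<ominus>\<^bsub>tensor_alg m\<^esub> q = p + q"
    using assms by (simp add: a_minus_def T_minus tensor_ops)
  then show ?thesis
    using TR.quotient_eq_iff_same_a_r_cos[OF CI.is_ideal assms] by (simp add: cl_of_def)
qed

lemma cl_carrier_iff: "x \<in> carrier (Cl m) \<longleftrightarrow> (\<exists>p \<in> T. x = cl_of m p)"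
  by (auto simp: Cl_def cl_of_def FactRing_def A_RCOSETS_def')

definition cong :: "tensor \<Rightarrow> tensor \<Rightarrow> bool" (infix "\<simeq>\<^sub>C" 50) where
  "p \<simeq>\<^sub>C q \<longleftrightarrow> p \<in> T \<and> q \<in> T \<and> cl_of m p = cl_of m q"

lemma cong_refl: "p \<in> T \<Longrightarrow> p \<simeq>\<^sub>C p"
  by (simp add: cong_def)

lemma cong_sym: "p \<simeq>\<^sub>C q \<Longrightarrow> q \<simeq>\<^sub>C p"
  by (simp add: cong_def)

lemma cong_trans [trans]: "p \<simeq>\<^sub>C q \<Longrightarrow> q \<simeq>\<^sub>C r \<Longrightarrow> p \<simeq>\<^sub>C r"
  by (simp add: cong_def)

lemma cong_add: "p \<simeq>\<^sub>C p' \<Longrightarrow> q \<simeq>\<^sub>C q' \<Longrightarrow> p + q \<simeq>\<^sub>C p' + q'"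
  by (simp add: cong_def T_add cl_of_add)

lemma cong_mult: "p \<simeq>\<^sub>C p' \<Longrightarrow> q \<simeq>\<^sub>C q' \<Longrightarrow> p * q \<simeq>\<^sub>C p' * q'"
  by (simp add: cong_def T_mult cl_of_mult)

lemma cong_mult_left: "r \<in> T \<Longrightarrow> p \<simeq>\<^sub>C p' \<Longrightarrow> r * p \<simeq>\<^sub>C r * p'"
  by (simp add: cong_mult cong_refl)

lemma cong_mult_right: "p \<simeq>\<^sub>C p' \<Longrightarrow> r \<in> T \<Longrightarrow> p * r \<simeq>\<^sub>C p' * r"
  by (simp add: cong_mult cong_refl)

lemma cong_add_left: "r \<in> T \<Longrightarrow> p \<simeq>\<^sub>C p' \<Longrightarrow> r + p \<simeq>\<^sub>C r + p'"
  by (simp add: cong_add cong_refl)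

lemma cong_add_right: "p \<simeq>\<^sub>C p' \<Longrightarrow> r \<in> T \<Longrightarrow> p + r \<simeq>\<^sub>C p' + r"
  by (simp add: cong_add cong_refl)

lemma cong_sum: "(\<And>i. i \<in> A \<Longrightarrow> f i \<simeq>\<^sub>C g i) \<Longrightarrow> sum f A \<simeq>\<^sub>C sum g A"
  by (induction A rule: infinite_finite_induct) (simp_all add: cong_refl T_0 cong_add)

text \<open>In characteristic two any term may change sides.\<close>

lemma cong_swap_sides: "p + q \<simeq>\<^sub>C r \<Longrightarrow> q \<in> T \<Longrightarrow> p \<simeq>\<^sub>C q + r"
  using cong_add[of "p + q" r q q] by (simp add: cong_refl ac_simps tensor_add_self)

lemma tvec_square:
  assumes "x \<in> Vmod m"
  shows "tvec m x * tvec m x \<simeq>\<^sub>C tscal (qform m x)"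
proof -
  have "tvec m x * tvec m x - tscal (qform m x) \<in> I"
    unfolding cliff_ideal_def using assms
    by (intro TR.genideal_self[THEN subsetD]) (auto simp: tensor_diff intro!: T_intros)
  then show ?thesis
    by (simp add: cong_def cl_of_eq_iff T_intros tensor_diff)
qed

lemma tgen_square:
  assumes "i \<le> m"
  shows "tgen i * tgen i \<simeq>\<^sub>C tscal (if i = 0 then 1 else cr_sinv\<^sup>2)"
proof -
  have "basis_vec i \<in> Vmod m" using assms by (auto simp: Vmod_def basis_vec_def)
  from tvec_square[OF this] assms show ?thesis by (simp add: tvec_basis_vec qform_basis)
qed

text \<open>The relation \<open>anticomm p q c\<close> is the polarized Clifford relation; it is additive in both
  arguments, which gives the values on all vectors needed from those on the basis.\<close>

definition anticomm :: "tensor \<Rightarrow> tensor \<Rightarrow> coeff_ring \<Rightarrow> bool" where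
  "anticomm p q c \<longleftrightarrow> p \<in> T \<and> q \<in> T \<and> p * q + q * p \<simeq>\<^sub>C tscal c"

lemma anticomm_tgen:
  assumes "i \<le> m" "j \<le> m"
  shows "anticomm (tgen i) (tgen j) (if i = j then 0 else 1)"
proof -
  let ?x = "basis_vec i" and ?y = "basis_vec j"
  let ?p = "tgen i" and ?q = "tgen j"
  have V: "?x \<in> Vmod m" "?y \<in> Vmod m" "(\<lambda>k. ?x k + ?y k) \<in> Vmod m"
    using assms by (auto simp: Vmod_def basis_vec_def)
  have "(?p + ?q) * (?p + ?q) \<simeq>\<^sub>C
      tscal (qform m ?x) + tscal (qform m ?y) + tscal (if i = j then 0 else 1)"
    using tvec_square[OF V(3)] assms
    by (simp add: tvec_add tvec_basis_vec qform_polar bform_basis tscal_simps)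
  moreover have "?p * ?p \<simeq>\<^sub>C tscal (qform m ?x)" "?q * ?q \<simeq>\<^sub>C tscal (qform m ?y)"
    using tvec_square[OF V(1)] tvec_square[OF V(2)] assms by (simp_all add: tvec_basis_vec)
  ultimately have "(?p + ?q) * (?p + ?q) + (?p * ?p + ?q * ?q) \<simeq>\<^sub>C
      (tscal (qform m ?x) + tscal (qform m ?y) + tscal (if i = j then 0 else 1)) +
      (tscal (qform m ?x) + tscal (qform m ?y))"
    by (intro cong_add)
  moreover have "(?p + ?q) * (?p + ?q) + (?p * ?p + ?q * ?q) = ?p * ?q + ?q * ?p"
    by (simp add: algebra_simps tensor_add_self tensor_add_self_left)
  moreover have "(a + b + c) + (a + b) = c" for a b c :: tensor
    by (simp add: algebra_simps tensor_add_self tensor_add_self_left)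
  ultimately show ?thesis by (simp add: anticomm_def T_tgen assms)
qed

lemma anticomm_add_right:
  assumes "anticomm p q c" "anticomm p r d"
  shows "anticomm p (q + r) (c + d)"
proof -
  have "(p * q + q * p) + (p * r + r * p) \<simeq>\<^sub>C tscal c + tscal d"
    using assms by (intro cong_add) (auto simp: anticomm_def)
  moreover have "(p * q + q * p) + (p * r + r * p) = p * (q + r) + (q + r) * p"
    by (simp add: algebra_simps)
  ultimately show ?thesis
    using assms by (simp add: anticomm_def T_add tscal_simps)
qed

lemma anticomm_commute: "anticomm p q c \<Longrightarrow> anticomm q p c"
  by (simp add: anticomm_def add.commute)

lemma anticomm_add_left: "anticomm p r c \<Longrightarrow> anticomm q r d \<Longrightarrow> anticomm (p + q) r (c + d)"
  using anticomm_add_right anticomm_commute by blast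

lemma anticomm_swap: "anticomm p q c \<Longrightarrow> p * q \<simeq>\<^sub>C q * p + tscal c"
  by (auto simp: anticomm_def intro: cong_swap_sides T_mult)

lemma anticomm_0_swap: "anticomm p q 0 \<Longrightarrow> p * q \<simeq>\<^sub>C q * p"
  using anticomm_swap[of p q 0] by (simp add: tscal_simps)

lemma anticomm_1_swap: "anticomm p q 1 \<Longrightarrow> p * q \<simeq>\<^sub>C q * p + 1"
  using anticomm_swap[of p q 1] by (simp add: tscal_simps)

end

section \<open>Relations between the images of the generators\<close>

lemma cr_alpha_square: "cr_alpha * cr_alpha = cr_s * cr_alpha + 1"
proof -
  have "cr_alpha * cr_alpha + (cr_s * cr_alpha + 1) = 0"
    using cr_alpha_root by (simp add: power2_eq_square add.assoc)
  then show ?thesis by (metis add_eq_0_iff2 cr_minus_eq)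
qed

lemma cr_add_self_left: "(x :: coeff_ring) + (x + y) = y"
  by (simp add: add.assoc[symmetric] cr_add_self)

lemma cr_alphainv_add_s: "cr_alphainv + cr_s = cr_alpha"
  by (metis cr_alphainv_def cr_add_self_left add.commute)

lemma cr_alpha_add_s: "cr_alpha + cr_s = cr_alphainv"
  by (simp add: cr_alphainv_def ac_simps)

lemma cr_alpha_quadratic: "cr_alpha\<^sup>2 * cr_sinv = cr_alpha + cr_sinv"
proof -
  have "cr_alpha\<^sup>2 * cr_sinv = (cr_s * cr_sinv) * cr_alpha + cr_sinv"
    by (simp add: power2_eq_square cr_alpha_square algebra_simps)
  then show ?thesis by (simp add: cr_s_inverse)
qed

text \<open>The eigenvalue of right multiplication by \<open>u v\<^sub>1\<close> on \<open>w\<close>: one of the two roots of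
  \<open>x\<^sup>2 + x = 1/t\<close>, the equation satisfied by \<open>u v\<^sub>1\<close>.\<close>

definition cr_c :: coeff_ring where "cr_c = cr_alpha * cr_sinv"

lemma cr_s_c: "cr_s * cr_c = cr_alpha"
  using cr_s_inverse by (simp add: cr_c_def mult.left_commute)

lemma cr_c_root: "cr_c * (1 + cr_c) = cr_sinv\<^sup>2"
proof -
  have "cr_c * (1 + cr_c) = cr_alpha * cr_sinv + (cr_alpha\<^sup>2 * cr_sinv) * cr_sinv"
    by (simp add: cr_c_def power2_eq_square algebra_simps)
  also have "\<dots> = cr_sinv\<^sup>2"
    by (simp only: cr_alpha_quadratic)
      (simp add: distrib_right power2_eq_square cr_add_self_left)
  finally show ?thesis .
qed

text \<open>Representatives, in the tensor algebra, of \<open>u v\<^sub>i\<close>, of the images of the generators and of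
  \<open>w\<close>. The inverse of \<open>a\<close> is \<open>a + s\<close> because \<open>a\<close> is a root of \<open>x\<^sup>2 + s x + 1\<close>, as \<open>\<alpha>\<close> is.\<close>

definition t_uv :: "nat \<Rightarrow> tensor" where "t_uv i = t_u * t_v i"
definition t_sig :: "nat \<Rightarrow> tensor" where "t_sig i = t_u * (t_v i + t_v (i + 1))"
definition t_a :: tensor where "t_a = tscal cr_s * t_u * t_v 1"
definition t_ainv :: tensor where "t_ainv = t_a + tscal cr_s"
definition t_w :: tensor where
  "t_w = tscal (cr_alpha\<^sup>2 * cr_sinv) + tscal cr_alpha * t_u * t_v 1
     + tscal cr_alphainv * t_u * t_v 2 + tscal cr_s * t_v 1 * t_v 2"

context clifford
begin

lemma T_elems: "i \<le> m \<Longrightarrow> t_uv i \<in> T" "i < m \<Longrightarrow> t_sig i \<in> T" "t_a \<in> T" "t_ainv \<in> T" "t_w \<in> T"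
  using m_ge
  by (auto simp: t_uv_def t_sig_def t_a_def t_ainv_def t_w_def intro!: T_intros)

text \<open>Moving \<open>v\<^sub>i\<close> past the inner \<open>u\<close> costs one term, and the two \<open>u\<close> then cancel.\<close>

lemma uv_mult_uv:
  assumes "1 \<le> i" "i \<le> m" "j \<le> m"
  shows "t_uv i * t_uv j \<simeq>\<^sub>C t_v i * t_v j + t_uv j"
proof -
  have "t_uv i * t_uv j = t_u * (t_v i * t_u) * t_v j"
    by (simp add: t_uv_def mult.assoc)
  also have "\<dots> \<simeq>\<^sub>C t_u * (t_u * t_v i + 1) * t_v j"
    using anticomm_tgen[of i 0] assms
    by (intro cong_mult_right cong_mult_left anticomm_1_swap T_intros) auto
  also have "\<dots> = (t_u * t_u) * (t_v i * t_v j) + t_uv j"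
    by (simp add: t_uv_def algebra_simps)
  also have "\<dots> \<simeq>\<^sub>C tscal 1 * (t_v i * t_v j) + t_uv j"
    using tgen_square[of 0] assms
    by (intro cong_add_right cong_mult_right T_intros T_elems) auto
  finally show ?thesis by (simp add: tscal_simps)
qed

lemma uv_square:
  assumes "1 \<le> i" "i \<le> m"
  shows "t_uv i * t_uv i \<simeq>\<^sub>C tscal (cr_sinv\<^sup>2) + t_uv i"
proof -
  note uv_mult_uv[OF assms assms(2)]
  also have "t_v i * t_v i + t_uv i \<simeq>\<^sub>C tscal (cr_sinv\<^sup>2) + t_uv i"
    using tgen_square[of i] assms by (intro cong_add_right T_elems) auto
  finally show ?thesis .
qed

lemma uv_swap:
  assumes "1 \<le> i" "i \<le> m" "1 \<le> j" "j \<le> m" "i \<noteq> j"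
  shows "t_uv j * t_uv i \<simeq>\<^sub>C (1 + t_uv i) * (1 + t_uv j)"
proof -
  have "t_uv j * t_uv i + t_uv i * t_uv j \<simeq>\<^sub>C
      (t_v j * t_v i + t_uv i) + (t_v i * t_v j + t_uv j)"
    using assms by (intro cong_add uv_mult_uv)
  also have "\<dots> = (t_v j * t_v i + t_v i * t_v j) + (t_uv i + t_uv j)" by (simp add: ac_simps)
  also have "\<dots> \<simeq>\<^sub>C tscal 1 + (t_uv i + t_uv j)"
    using anticomm_tgen[of j i] assms
    by (intro cong_add_right T_intros T_elems) (auto simp: anticomm_def)
  finally have "t_uv j * t_uv i \<simeq>\<^sub>C t_uv i * t_uv j + (tscal 1 + (t_uv i + t_uv j))"
    by (rule cong_swap_sides) (intro T_intros T_elems assms)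
  then show ?thesis by (simp add: tscal_simps algebra_simps)
qed

abbreviation "A \<equiv> t_uv 1"
abbreviation "B \<equiv> t_uv 2"
abbreviation "P \<equiv> tscal cr_alpha + tscal cr_s * A"

lemma T_AB: "A \<in> T" "B \<in> T" "P \<in> T"
  using m_ge by (auto intro!: T_intros T_elems)

text \<open>The quadratic equation of \<open>u v\<^sub>1\<close> splits over the coefficient ring; \<open>P\<close> is, up to the unit
  \<open>s\<close>, one of its two factors evaluated at \<open>u v\<^sub>1\<close>, hence an eigenvector.\<close>

lemma P_eigen: "P * (1 + A) \<simeq>\<^sub>C tscal cr_c * P"
proof -
  have "P * (1 + A) = tscal cr_alpha + tscal cr_alpha * A + tscal cr_s * A + tscal cr_s * (A * A)"
    by (simp add: algebra_simps)
  also have "\<dots> \<simeq>\<^sub>C tscal cr_alpha + tscal cr_alpha * A + tscal cr_s * A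
      + tscal cr_s * (tscal (cr_sinv\<^sup>2) + A)"
    using m_ge by (intro cong_add_left cong_mult_left uv_square T_intros T_AB) auto
  also have "\<dots> = tscal (cr_alpha + cr_s * cr_sinv\<^sup>2) + tscal cr_alpha * A"
    by (simp add: tscal_simps algebra_simps tensor_add_self tensor_add_self_left)
  also have "cr_alpha + cr_s * cr_sinv\<^sup>2 = cr_c * cr_alpha"
    using cr_alpha_quadratic cr_s_inverse
    by (simp add: cr_c_def power2_eq_square mult.assoc[symmetric]) (simp add: ac_simps)
  also have "tscal (cr_c * cr_alpha) + tscal cr_alpha * A = tscal cr_c * P"
    using cr_s_c by (simp add: tscal_simps distrib_left mult.assoc[symmetric])
      (simp add: tscal_simps(2)[symmetric] mult.commute)
  finally show ?thesis .
qed

text \<open>Modulo the Clifford relations, the first factor is an eigenvector for right multiplication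
  by \<open>u v\<^sub>1\<close>, and the second one for right multiplication by \<open>u v\<^sub>2\<close>.\<close>

lemma w_factor: "t_w \<simeq>\<^sub>C P * (tscal cr_c + B)"
proof -
  have vv: "t_v 1 * t_v 2 \<simeq>\<^sub>C B + A * B"
    using cong_swap_sides[OF cong_sym[OF uv_mult_uv[of 1 2]]] m_ge by (simp add: T_AB)
  have "t_w = tscal (cr_alpha\<^sup>2 * cr_sinv) + tscal cr_alpha * A + tscal cr_alphainv * B
      + tscal cr_s * (t_v 1 * t_v 2)"
    by (simp add: t_w_def t_uv_def mult.assoc)
  also have "\<dots> \<simeq>\<^sub>C tscal (cr_alpha\<^sup>2 * cr_sinv) + tscal cr_alpha * A + tscal cr_alphainv * B
      + tscal cr_s * (B + A * B)"
    by (intro cong_add_left cong_mult_left vv T_intros T_AB)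
  also have "\<dots> = tscal (cr_alpha * cr_c) + tscal (cr_s * cr_c) * A + tscal (cr_alphainv + cr_s) * B
      + tscal cr_s * (A * B)"
    unfolding cr_s_c by (simp add: tscal_simps algebra_simps cr_c_def power2_eq_square)
  also have "\<dots> = P * (tscal cr_c + B)"
    unfolding cr_alphainv_add_s
    by (simp add: tscal_simps algebra_simps tscal_central[of A] del: One_nat_def)
  finally show ?thesis .
qed

text \<open>Moving \<open>u v\<^sub>1\<close> to the left past \<open>u v\<^sub>2\<close> produces factors \<open>1 + u v\<^sub>1\<close>, on which \<open>P_eigen\<close>
  can be used; this works because the eigenvalue is the constant term of the second factor.\<close>

lemma w_mult_uv1: "t_w * A \<simeq>\<^sub>C tscal cr_c * t_w"
proof -
  have distr: "p * (tscal c + b) * a = tscal c * p * a + p * (b * a)" for p a b c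
    by (simp add: distrib_left distrib_right mult.assoc tscal_left_commute[of p])
  have "t_w * A \<simeq>\<^sub>C P * (tscal cr_c + B) * A"
    by (intro cong_mult_right w_factor T_AB)
  also have "\<dots> = tscal cr_c * P * A + P * (B * A)"
    by (rule distr)
  also have "\<dots> \<simeq>\<^sub>C tscal cr_c * P * A + P * ((1 + A) * (1 + B))"
    using m_ge by (intro cong_add_left cong_mult_left uv_swap T_intros T_AB) auto
  also have "\<dots> = tscal cr_c * P * A + (P * (1 + A)) * (1 + B)"
    by (simp add: mult.assoc)
  also have "\<dots> \<simeq>\<^sub>C tscal cr_c * P * A + (tscal cr_c * P) * (1 + B)"
    by (intro cong_add_left cong_mult_right P_eigen T_intros T_AB)
  also have "\<dots> = tscal cr_c * (P * (1 + A) + P * B)"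
    by (simp add: algebra_simps)
  also have "\<dots> \<simeq>\<^sub>C tscal cr_c * (tscal cr_c * P + P * B)"
    by (intro cong_mult_left cong_add_right P_eigen T_intros T_AB)
  also have "\<dots> = tscal cr_c * (P * (tscal cr_c + B))"
    by (simp only: distrib_left[of P] tscal_central[of P])
  also have "\<dots> \<simeq>\<^sub>C tscal cr_c * t_w"
    by (intro cong_mult_left cong_sym[OF w_factor] T_intros)
  finally show ?thesis .
qed

lemma w_mult_uv2: "t_w * B \<simeq>\<^sub>C tscal (1 + cr_c) * t_w"
proof -
  have "t_w * B \<simeq>\<^sub>C P * (tscal cr_c + B) * B"
    by (intro cong_mult_right w_factor T_AB)
  also have "\<dots> = P * (tscal cr_c * B + B * B)"
    by (simp only: mult.assoc distrib_right)
  also have "\<dots> \<simeq>\<^sub>C P * (tscal cr_c * B + (tscal (cr_sinv\<^sup>2) + B))"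
    using m_ge by (intro cong_mult_left cong_add_left uv_square T_intros T_AB) auto
  also have "tscal cr_c * B + (tscal (cr_sinv\<^sup>2) + B) = tscal (1 + cr_c) * (tscal cr_c + B)"
    unfolding cr_c_root[symmetric] by (simp add: tscal_simps algebra_simps)
  also have "P * \<dots> = tscal (1 + cr_c) * (P * (tscal cr_c + B))"
    by (rule tscal_left_commute)
  also have "\<dots> \<simeq>\<^sub>C tscal (1 + cr_c) * t_w"
    by (intro cong_mult_left cong_sym[OF w_factor] T_intros)
  finally show ?thesis .
qed

lemma w_mult_a: "t_w * t_a \<simeq>\<^sub>C tscal cr_alpha * t_w"
proof -
  have "t_w * t_a = tscal cr_s * (t_w * A)"
    by (simp add: t_a_def t_uv_def mult.assoc tscal_left_commute)
  also have "\<dots> \<simeq>\<^sub>C tscal cr_s * (tscal cr_c * t_w)"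
    by (intro cong_mult_left w_mult_uv1 T_intros)
  also have "\<dots> = tscal cr_alpha * t_w"
    by (simp add: mult.assoc[symmetric] tscal_simps(2)[symmetric] cr_s_c)
  finally show ?thesis .
qed

lemma w_mult_ainv: "t_w * t_ainv \<simeq>\<^sub>C tscal cr_alphainv * t_w"
proof -
  have "t_w * t_ainv = t_w * t_a + tscal cr_s * t_w"
    by (simp add: t_ainv_def distrib_left tscal_central[of t_w])
  also have "\<dots> \<simeq>\<^sub>C tscal cr_alpha * t_w + tscal cr_s * t_w"
    by (intro cong_add_right w_mult_a T_intros T_elems)
  also have "\<dots> = tscal cr_alphainv * t_w"
    by (simp only: cr_alpha_add_s distrib_right[symmetric] tscal_simps(1)[symmetric])
  finally show ?thesis .
qed

text \<open>The eigenvalues of \<open>u v\<^sub>1\<close> and \<open>u v\<^sub>2\<close> on \<open>w\<close> are \<open>c\<close> and \<open>1 + c\<close>, with sum \<open>1\<close>.\<close>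

lemma w_mult_sig1: "t_w * t_sig 1 \<simeq>\<^sub>C t_w"
proof -
  have "t_w * t_sig 1 = t_w * A + t_w * B"
    by (simp add: t_sig_def t_uv_def distrib_left one_add_one del: One_nat_def)
  also have "\<dots> \<simeq>\<^sub>C tscal cr_c * t_w + tscal (1 + cr_c) * t_w"
    by (intro cong_add w_mult_uv1 w_mult_uv2)
  also have "\<dots> = t_w"
    by (simp add: tscal_simps algebra_simps tensor_add_self tensor_add_self_left)
  finally show ?thesis .
qed

lemma a_ainv: "t_a * t_ainv \<simeq>\<^sub>C 1" "t_ainv * t_a \<simeq>\<^sub>C 1"
proof -
  have a: "t_a = tscal cr_s * A" by (simp add: t_a_def t_uv_def mult.assoc)
  have "t_a * t_ainv = tscal (cr_s\<^sup>2) * (A * A + A)"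
    by (simp add: t_ainv_def a tscal_simps power2_eq_square algebra_simps tscal_left_commute[of A] tscal_central[of A]
        del: One_nat_def)
  also have "\<dots> \<simeq>\<^sub>C tscal (cr_s\<^sup>2) * ((tscal (cr_sinv\<^sup>2) + A) + A)"
    using m_ge by (intro cong_mult_left cong_add_right uv_square T_intros T_AB) auto
  also have "\<dots> = tscal ((cr_s * cr_sinv)\<^sup>2)"
    by (simp add: power_mult_distrib tscal_simps add.assoc tensor_add_self)
  finally show 1: "t_a * t_ainv \<simeq>\<^sub>C 1" by (simp add: cr_s_inverse tscal_simps)
  have "t_ainv * t_a = t_a * t_ainv" by (simp add: t_ainv_def algebra_simps tscal_central[of t_a])
  with 1 show "t_ainv * t_a \<simeq>\<^sub>C 1" by simp
qed

text \<open>Since \<open>v\<^sub>i + v\<^sub>i\<^sub>+\<^sub>1\<close> commutes with \<open>u\<close>, and \<open>u\<^sup>2 = 1\<close>, the products of two elements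
  \<open>t_sig i\<close> agree with the products of these vectors.\<close>

abbreviation dvec :: "nat \<Rightarrow> tensor" where "dvec i \<equiv> t_v i + t_v (i + 1)"

lemma anticomm_dvec_tgen:
  assumes "i < m" "j \<le> m"
  shows "anticomm (dvec i) (tgen j) (if j = i \<or> j = i + 1 then 1 else 0)"
  using anticomm_add_left[OF anticomm_tgen[of i j] anticomm_tgen[of "i + 1" j]] assms
  by (auto split: if_splits simp: cr_add_self)

lemma anticomm_dvec:
  assumes "i < m" "j < m"
  shows "anticomm (dvec i) (dvec j) (if j = i + 1 \<or> i = j + 1 then 1 else 0)"
  using anticomm_add_right[OF anticomm_dvec_tgen[of i j] anticomm_dvec_tgen[of i "j + 1"]] assms
  by (auto split: if_splits simp: cr_add_self)

lemma T_dvec: "i < m \<Longrightarrow> dvec i \<in> T"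
  by (intro T_intros) auto

lemma sig_mult_sig:
  assumes "1 \<le> i" "i < m" "j < m"
  shows "t_sig i * t_sig j \<simeq>\<^sub>C dvec i * dvec j"
proof -
  have "t_sig i * t_sig j = t_u * (dvec i * t_u) * dvec j"
    by (simp add: t_sig_def mult.assoc)
  also have "\<dots> \<simeq>\<^sub>C t_u * (t_u * dvec i) * dvec j"
    using anticomm_dvec_tgen[of i 0] assms
    by (intro cong_mult_right cong_mult_left anticomm_0_swap T_dvec T_intros) auto
  also have "\<dots> = (t_u * t_u) * (dvec i * dvec j)" by (simp add: mult.assoc)
  also have "\<dots> \<simeq>\<^sub>C tscal 1 * (dvec i * dvec j)"
    using tgen_square[of 0] assms by (intro cong_mult_right T_mult T_dvec) auto
  finally show ?thesis by (simp add: tscal_simps)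
qed

lemma sig_square:
  assumes "1 \<le> i" "i < m"
  shows "t_sig i * t_sig i \<simeq>\<^sub>C 1"
proof -
  note sig_mult_sig[OF assms assms(2)]
  also have "dvec i * dvec i = t_v i * t_v i + (t_v (i+1) * t_v (i+1) +
      (t_v i * t_v (i+1) + t_v (i+1) * t_v i))"
    by (simp add: algebra_simps)
  also have "\<dots> \<simeq>\<^sub>C tscal (cr_sinv\<^sup>2) + (tscal (cr_sinv\<^sup>2) + tscal 1)"
    using tgen_square[of i] tgen_square[of "i+1"] anticomm_tgen[of i "i+1"] assms
    by (intro cong_add) (auto simp: anticomm_def)
  finally show ?thesis by (simp add: tscal_simps tensor_add_self_left)
qed

lemma sig_anticomm:
  assumes "1 \<le> i" "i < m" "1 \<le> j" "j < m"
  shows "t_sig i * t_sig j \<simeq>\<^sub>C t_sig j * t_sig i + tscal (if j = i + 1 \<or> i = j + 1 then 1 else 0)"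
proof -
  have "t_sig i * t_sig j + t_sig j * t_sig i \<simeq>\<^sub>C dvec i * dvec j + dvec j * dvec i"
    using assms by (intro cong_add sig_mult_sig)
  also have "\<dots> \<simeq>\<^sub>C tscal (if j = i + 1 \<or> i = j + 1 then 1 else 0)"
    using anticomm_dvec[OF assms(2,4)] by (simp add: anticomm_def)
  finally show ?thesis
    using assms by (intro cong_swap_sides T_mult T_elems)
qed

lemma sig_commute:
  assumes "1 \<le> i" "i < m" "1 \<le> j" "j < m" "j \<noteq> i + 1" "i \<noteq> j + 1"
  shows "t_sig i * t_sig j \<simeq>\<^sub>C t_sig j * t_sig i"
  using sig_anticomm[OF assms(1-4)] assms(5,6) by (simp add: tscal_simps)

lemma sig_braid:
  assumes "1 \<le> i" "i < m" "1 \<le> j" "j < m" "j = i + 1 \<or> i = j + 1"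
  shows "t_sig i * t_sig j \<simeq>\<^sub>C t_sig j * t_sig i + 1"
  using sig_anticomm[OF assms(1-4)] assms(5) by (simp add: tscal_simps split: if_splits)

text \<open>Both \<open>\<sigma>\<^sub>i u v\<^sub>1\<close> and \<open>(u v\<^sub>1 + 1) \<sigma>\<^sub>i\<close> reduce to \<open>v\<^sub>1 (v\<^sub>i + v\<^sub>i\<^sub>+\<^sub>1)\<close>; here \<open>i \<ge> 2\<close> makes
  \<open>v\<^sub>1\<close> orthogonal to \<open>v\<^sub>i + v\<^sub>i\<^sub>+\<^sub>1\<close>.\<close>

lemma sig_a:
  assumes "2 \<le> i" "i < m"
  shows "t_sig i * t_a \<simeq>\<^sub>C t_ainv * t_sig i" "t_sig i * t_ainv \<simeq>\<^sub>C t_a * t_sig i"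
proof -
  have d: "dvec i * t_u \<simeq>\<^sub>C t_u * dvec i" "dvec i * t_v 1 \<simeq>\<^sub>C t_v 1 * dvec i"
    using anticomm_dvec_tgen[of i 0] anticomm_dvec_tgen[of i 1] assms m_ge
    by (auto intro: anticomm_0_swap)
  have uu: "t_u * t_u \<simeq>\<^sub>C tscal 1" using tgen_square[of 0] by simp
  have v1: "t_v 1 \<in> T" and u: "t_u \<in> T" and dT: "dvec i \<in> T"
    using assms by (auto intro!: T_intros)
  have "t_sig i * A = t_u * (dvec i * t_u) * t_v 1"
    by (simp add: t_sig_def t_uv_def mult.assoc)
  also have "\<dots> \<simeq>\<^sub>C t_u * (t_u * dvec i) * t_v 1"
    by (intro cong_mult_right cong_mult_left d u v1)
  also have "\<dots> = (t_u * t_u) * (dvec i * t_v 1)" by (simp add: mult.assoc)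
  also have "\<dots> \<simeq>\<^sub>C tscal 1 * (t_v 1 * dvec i)"
    by (intro cong_mult uu d)
  finally have l: "t_sig i * A \<simeq>\<^sub>C t_v 1 * dvec i" by (simp add: tscal_simps)
  have "(A + 1) * t_sig i = t_u * (t_v 1 * t_u) * dvec i + t_sig i"
    by (simp add: t_sig_def t_uv_def algebra_simps)
  also have "\<dots> \<simeq>\<^sub>C t_u * (t_u * t_v 1 + 1) * dvec i + t_sig i"
    using anticomm_tgen[of 1 0] m_ge assms
    by (intro cong_add_right cong_mult_right cong_mult_left anticomm_1_swap u dT T_elems) auto
  also have "\<dots> = (t_u * t_u) * (t_v 1 * dvec i)"
    by (simp add: t_sig_def algebra_simps tensor_add_self tensor_add_self_left)
  also have "\<dots> \<simeq>\<^sub>C tscal 1 * (t_v 1 * dvec i)"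
    by (intro cong_mult_right uu T_mult v1 dT)
  finally have r: "(A + 1) * t_sig i \<simeq>\<^sub>C t_v 1 * dvec i" by (simp add: tscal_simps)
  have "t_sig i * t_a = tscal cr_s * (t_sig i * A)"
    by (simp add: t_a_def t_uv_def mult.assoc tscal_left_commute)
  also have "\<dots> \<simeq>\<^sub>C tscal cr_s * ((A + 1) * t_sig i)"
    by (intro cong_mult_left T_intros cong_trans[OF l cong_sym[OF r]])
  also have "\<dots> = t_ainv * t_sig i"
    by (simp add: t_ainv_def t_a_def t_uv_def algebra_simps)
  finally show 1: "t_sig i * t_a \<simeq>\<^sub>C t_ainv * t_sig i" .
  have "t_sig i * t_ainv = t_sig i * t_a + tscal cr_s * t_sig i"
    by (simp add: t_ainv_def algebra_simps tscal_central[of "t_sig i"])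
  also have "\<dots> \<simeq>\<^sub>C t_ainv * t_sig i + tscal cr_s * t_sig i"
    using assms by (intro cong_add_right 1 T_mult T_tscal T_elems)
  also have "\<dots> = t_a * t_sig i"
    by (simp add: t_ainv_def algebra_simps tensor_add_self tensor_add_self_left)
  finally show "t_sig i * t_ainv \<simeq>\<^sub>C t_a * t_sig i" .
qed

end

section \<open>Matrices of the generators\<close>

definition lincomb :: "(nat \<Rightarrow> coeff_ring) \<Rightarrow> tensor list \<Rightarrow> tensor" where
  "lincomb c ys = (\<Sum>j<length ys. tscal (c j) * ys ! j)"

definition double :: "tensor list \<Rightarrow> tensor \<Rightarrow> tensor list" where
  "double ys g = ys @ map (\<lambda>y. y * g) ys"

lemma length_double: "length (double ys g) = length ys + length ys"
  by (simp add: double_def)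

lemma lincomb_cong:
  "(\<And>j. j < length ys \<Longrightarrow> c j = d j) \<Longrightarrow> lincomb c ys = lincomb d ys"
  by (simp add: lincomb_def)

lemma lincomb_zero: "lincomb (\<lambda>_. 0) ys = 0"
  by (simp add: lincomb_def tscal_simps)

lemma lincomb_unit:
  assumes "i < length ys"
  shows "lincomb (\<lambda>j. if i = j then 1 else 0) ys = ys ! i"
proof -
  have "lincomb (\<lambda>j. if i = j then 1 else 0) ys = (\<Sum>j<length ys. if i = j then ys ! j else 0)"
    unfolding lincomb_def by (intro sum.cong refl) (auto simp: tscal_simps)
  then show ?thesis using assms by simp
qed

lemma sum_lessThan_add:
  "(\<Sum>j<a + b. f j) = (\<Sum>j<a. f j) + (\<Sum>j<b. f (a + j :: nat))"
  for f :: "nat \<Rightarrow> 'a :: comm_monoid_add"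
  by (induction b) (simp_all add: add.assoc)

lemma lincomb_double:
  "lincomb c (double ys g) = lincomb c ys + lincomb (\<lambda>j. c (length ys + j)) ys * g"
  unfolding lincomb_def length_double sum_lessThan_add sum_distrib_right
  by (intro arg_cong2[where f = "(+)"] sum.cong refl)
    (simp_all add: double_def nth_append mult.assoc)

context clifford
begin

lemma lincomb_closed: "set ys \<subseteq> T \<Longrightarrow> lincomb c ys \<in> T"
  by (auto simp: lincomb_def intro!: T_intros)

definition acts_by :: "tensor \<Rightarrow> tensor list \<Rightarrow> coeff_ring mat \<Rightarrow> bool" where
  "acts_by g ys M \<longleftrightarrow> M \<in> carrier_mat (length ys) (length ys) \<and>
    (\<forall>i < length ys. ys ! i * g \<simeq>\<^sub>C lincomb (\<lambda>j. M $$ (i, j)) ys)"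

text \<open>The lower blocks are read off by moving \<open>g\<close> in \<open>y h g\<close> to the left of \<open>h\<close>. The three ways in
  which generators of \<open>y(m)\<close> pass each other give the three block shapes of Sidki's recursion.\<close>

lemma acts_by_double:
  assumes "A' \<in> carrier_mat n n" "B' \<in> carrier_mat n n" "C' \<in> carrier_mat n n" "D' \<in> carrier_mat n n"
    and n: "length ys = n"
    and upper: "\<And>i. i < n \<Longrightarrow> ys ! i * g \<simeq>\<^sub>C
      lincomb (\<lambda>j. A' $$ (i, j)) ys + lincomb (\<lambda>j. B' $$ (i, j)) ys * h"
    and lower: "\<And>i. i < n \<Longrightarrow> ys ! i * h * g \<simeq>\<^sub>C
      lincomb (\<lambda>j. C' $$ (i, j)) ys + lincomb (\<lambda>j. D' $$ (i, j)) ys * h"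
  shows "acts_by g (double ys h) (four_block_mat A' B' C' D')"
  unfolding acts_by_def
proof (intro conjI allI impI)
  show "four_block_mat A' B' C' D' \<in> carrier_mat (length (double ys h)) (length (double ys h))"
    using assms(1,4) n by (auto simp: length_double)
  fix i assume i: "i < length (double ys h)"
  have [simp]: "dim_row A' = n" "dim_col A' = n" "dim_row D' = n" "dim_col D' = n"
    using assms(1,4) by auto
  let ?M = "four_block_mat A' B' C' D'"
  have idx: "?M $$ (i, j) = (if i < n then if j < n then A' $$ (i, j) else B' $$ (i, j - n)
      else if j < n then C' $$ (i - n, j) else D' $$ (i - n, j - n))" if "j < n + n" for j
    using i that n by (subst index_mat_four_block) (simp_all add: length_double)
  show "double ys h ! i * g \<simeq>\<^sub>C lincomb (\<lambda>j. ?M $$ (i, j)) (double ys h)"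
  proof (cases "i < n")
    case True
    have "lincomb (\<lambda>j. ?M $$ (i, j)) (double ys h) =
        lincomb (\<lambda>j. A' $$ (i, j)) ys + lincomb (\<lambda>j. B' $$ (i, j)) ys * h"
      unfolding lincomb_double using True n
      by (intro arg_cong2[where f = "(+)"] arg_cong2[where f = "(*)"] lincomb_cong refl)
        (simp_all add: idx)
    then show ?thesis using upper[OF True] True n by (simp add: double_def nth_append)
  next
    case False
    have "lincomb (\<lambda>j. ?M $$ (i, j)) (double ys h) =
        lincomb (\<lambda>j. C' $$ (i - n, j)) ys + lincomb (\<lambda>j. D' $$ (i - n, j)) ys * h"
      unfolding lincomb_double using False n
      by (intro arg_cong2[where f = "(+)"] arg_cong2[where f = "(*)"] lincomb_cong refl)
        (simp_all add: idx)
    then show ?thesis using lower[of "i - n"] False i n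
      by (simp add: double_def nth_append)
  qed
qed

lemma acts_by_length: "acts_by g ys M \<Longrightarrow> M \<in> carrier_mat (length ys) (length ys)"
  by (simp add: acts_by_def)

lemma lincomb_zero_mat: "i < length ys \<Longrightarrow> n = length ys \<Longrightarrow> lincomb (\<lambda>j. 0\<^sub>m n n $$ (i, j)) ys = 0"
  by (subst lincomb_cong[where d = "\<lambda>_. 0"]) (simp_all add: lincomb_zero)

lemma lincomb_one_mat: "i < length ys \<Longrightarrow> n = length ys \<Longrightarrow> lincomb (\<lambda>j. 1\<^sub>m n $$ (i, j)) ys = ys ! i"
  by (subst lincomb_cong[where d = "\<lambda>j. if i = j then 1 else 0"]) (simp_all add: lincomb_unit)

lemma acts_by_double_intertwined:
  assumes ys: "set ys \<subseteq> T" and h: "h \<in> T"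
    and g: "acts_by g ys M" and g': "acts_by g' ys M'"
    and hg: "h * g \<simeq>\<^sub>C g' * h" and n: "length ys = n"
  shows "acts_by g (double ys h) (four_block_mat M (0\<^sub>m n n) (0\<^sub>m n n) M')"
proof (rule acts_by_double)
  fix i assume i: "i < n"
  then have yi: "ys ! i \<in> T" using ys n by auto
  show "ys ! i * g \<simeq>\<^sub>C
      lincomb (\<lambda>j. M $$ (i, j)) ys + lincomb (\<lambda>j. 0\<^sub>m n n $$ (i, j)) ys * h"
    using g i n by (simp add: acts_by_def lincomb_zero_mat)
  have "ys ! i * h * g = ys ! i * (h * g)" by (rule mult.assoc)
  also have "\<dots> \<simeq>\<^sub>C ys ! i * (g' * h)" by (rule cong_mult_left[OF yi hg])
  also have "\<dots> = (ys ! i * g') * h" by (simp add: mult.assoc)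
  also have "\<dots> \<simeq>\<^sub>C lincomb (\<lambda>j. M' $$ (i, j)) ys * h"
    using g' i n h by (intro cong_mult_right) (auto simp: acts_by_def)
  finally show "ys ! i * h * g \<simeq>\<^sub>C
      lincomb (\<lambda>j. 0\<^sub>m n n $$ (i, j)) ys + lincomb (\<lambda>j. M' $$ (i, j)) ys * h"
    using i n by (simp add: lincomb_zero_mat)
qed (use g g' n in \<open>auto simp: acts_by_def\<close>)

lemma acts_by_double_braided:
  assumes ys: "set ys \<subseteq> T" and h: "h \<in> T"
    and g: "acts_by g ys M"
    and hg: "h * g \<simeq>\<^sub>C g * h + 1" and n: "length ys = n"
  shows "acts_by g (double ys h) (four_block_mat M (0\<^sub>m n n) (1\<^sub>m n) M)"
proof (rule acts_by_double)
  fix i assume i: "i < n"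
  then have yi: "ys ! i \<in> T" using ys n by auto
  show "ys ! i * g \<simeq>\<^sub>C
      lincomb (\<lambda>j. M $$ (i, j)) ys + lincomb (\<lambda>j. 0\<^sub>m n n $$ (i, j)) ys * h"
    using g i n by (simp add: acts_by_def lincomb_zero_mat)
  have "ys ! i * h * g = ys ! i * (h * g)" by (rule mult.assoc)
  also have "\<dots> \<simeq>\<^sub>C ys ! i * (g * h + 1)" by (rule cong_mult_left[OF yi hg])
  also have "\<dots> = ys ! i + (ys ! i * g) * h" by (simp add: algebra_simps)
  also have "\<dots> \<simeq>\<^sub>C ys ! i + lincomb (\<lambda>j. M $$ (i, j)) ys * h"
    using g i n h yi by (intro cong_add_left cong_mult_right) (auto simp: acts_by_def)
  finally show "ys ! i * h * g \<simeq>\<^sub>C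
      lincomb (\<lambda>j. 1\<^sub>m n $$ (i, j)) ys + lincomb (\<lambda>j. M $$ (i, j)) ys * h"
    using i n by (simp add: lincomb_one_mat)
qed (use g n in \<open>auto simp: acts_by_def\<close>)

lemma acts_by_double_swap:
  assumes ys: "set ys \<subseteq> T" and h: "h \<in> T"
    and hh: "h * h \<simeq>\<^sub>C 1" and n: "length ys = n"
  shows "acts_by h (double ys h) (four_block_mat (0\<^sub>m n n) (1\<^sub>m n) (1\<^sub>m n) (0\<^sub>m n n))"
proof (rule acts_by_double)
  fix i assume i: "i < n"
  then have yi: "ys ! i \<in> T" using ys n by auto
  show "ys ! i * h \<simeq>\<^sub>C
      lincomb (\<lambda>j. 0\<^sub>m n n $$ (i, j)) ys + lincomb (\<lambda>j. 1\<^sub>m n $$ (i, j)) ys * h"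
    using i n h yi by (simp add: lincomb_zero_mat lincomb_one_mat cong_refl T_mult)
  have "ys ! i * h * h = ys ! i * (h * h)" by (rule mult.assoc)
  also have "\<dots> \<simeq>\<^sub>C ys ! i * 1" by (rule cong_mult_left[OF yi hh])
  finally show "ys ! i * h * h \<simeq>\<^sub>C
      lincomb (\<lambda>j. 1\<^sub>m n $$ (i, j)) ys + lincomb (\<lambda>j. 0\<^sub>m n n $$ (i, j)) ys * h"
    using i n by (simp add: lincomb_zero_mat lincomb_one_mat)
qed (use n in auto)

text \<open>The list \<open>t_list k\<close> represents the first \<open>2^k\<close> elements of \<open>X\<^sub>m\<close>. It plays the part of
  \<open>X\<^sub>k\<^sub>+\<^sub>2\<close> for the subgroup generated by \<open>a\<close> and the last \<open>k\<close> of the \<open>s\<^sub>j\<close>; this is what makes an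
  induction with fixed \<open>m\<close> match a recursion that lowers \<open>m\<close>.\<close>

primrec t_list :: "nat \<Rightarrow> tensor list" where
  "t_list 0 = [t_w]"
| "t_list (Suc k) = double (t_list k) (t_sig (m - Suc k))"

lemma length_t_list: "length (t_list k) = 2 ^ k"
  by (induction k) (simp_all add: length_double)

lemma T_t_list: "k < m \<Longrightarrow> set (t_list k) \<subseteq> T"
  by (induction k) (auto simp: double_def T_elems T_mult)

lemma acts_by_singleton:
  "y \<in> T \<Longrightarrow> y * g \<simeq>\<^sub>C tscal c * y \<Longrightarrow> acts_by g [y] (mat 1 1 (\<lambda>_. c))"
  by (simp add: acts_by_def lincomb_def)

text \<open>The case \<open>r = 3\<close> has the same block form as the others, with blocks of size \<open>1\<close>.\<close>

lemma sidki_s_2: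
  assumes "3 \<le> r"
  shows "sidki_s r 2 = four_block_mat (0\<^sub>m (2 ^ (r - 3)) (2 ^ (r - 3))) (1\<^sub>m (2 ^ (r - 3)))
    (1\<^sub>m (2 ^ (r - 3))) (0\<^sub>m (2 ^ (r - 3)) (2 ^ (r - 3)))"
  using assms by (cases "r = 3")
    (auto simp: sidki_s.simps[of r] sidki_s.simps[of 3] Let_def less_Suc_eq mat_of_rows_list_def intro!: eq_matI)

lemma sidki_s_1:
  assumes "3 \<le> r"
  shows "sidki_s r 1 = four_block_mat (1\<^sub>m (2 ^ (r - 3))) (0\<^sub>m (2 ^ (r - 3)) (2 ^ (r - 3)))
    (1\<^sub>m (2 ^ (r - 3))) (1\<^sub>m (2 ^ (r - 3)))"
  using assms by (cases "r = 3")
    (auto simp: sidki_s.simps[of r] sidki_s.simps[of 3] Let_def less_Suc_eq mat_of_rows_list_def intro!: eq_matI)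

lemma sidki_a_3:
  "sidki_a 3 = four_block_mat (mat 1 1 (\<lambda>_. cr_alpha)) (0\<^sub>m 1 1) (0\<^sub>m 1 1)
    (mat 1 1 (\<lambda>_. cr_alphainv))"
  by (auto simp: sidki_a.simps[of 3] less_Suc_eq mat_of_rows_list_def intro!: eq_matI)

text \<open>Relative to \<open>t_list k\<close> the generator \<open>s\<^sub>j\<close> has the index \<open>j - (m - k) + 2\<close>: the last \<open>\<sigma>\<close>
  that was used for doubling has index \<open>2\<close>, its neighbour index \<open>3\<close>, and the others commute with
  it.\<close>

lemma sig_acts:
  assumes "1 \<le> k" "k \<le> m - 2" "m - k \<le> j" "j < m"
  shows "acts_by (t_sig j) (t_list k) (sidki_s (k + 2) (j + k + 2 - m))"
  using assms
proof (induction k arbitrary: j rule: nat_induct_at_least)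
  case base
  then have "j = m - 1" by simp
  moreover from this m_ge have "j + 1 + 2 - m = 2" by simp
  moreover have "acts_by (t_sig (m - 1)) (double [t_w] (t_sig (m - 1))) (sidki_s 3 2)"
    using m_ge acts_by_double_swap[of "[t_w]" "t_sig (m - 1)" 1]
    by (simp add: sidki_s_2 sig_square T_elems)
  ultimately show ?case by (simp add: numeral_3_eq_3)
next
  case (Suc k)
  let ?h = "t_sig (m - Suc k)"
  have len: "length (t_list k) = 2 ^ (Suc k + 2 - 3)" by (simp add: length_t_list)
  have ys: "set (t_list k) \<subseteq> T" using Suc.prems by (intro T_t_list) auto
  have h: "?h \<in> T" using Suc.prems m_ge by (intro T_elems) auto
  have list: "t_list (Suc k) = double (t_list k) ?h" by simp
  consider "j = m - Suc k" | "j = m - k" | "m - k < j" using Suc.prems by linarith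
  then show ?case
  proof cases
    case 1
    with Suc.prems m_ge have "j + Suc k + 2 - m = 2" by simp
    moreover have "acts_by ?h (t_list (Suc k)) (sidki_s (Suc k + 2) 2)"
      unfolding list using Suc.prems Suc.hyps
      by (subst sidki_s_2) (auto intro!: acts_by_double_swap ys h sig_square simp: length_t_list)
    ultimately show ?thesis using 1 by simp
  next
    case 2
    with Suc.prems m_ge have e: "j + Suc k + 2 - m = 3" "j + k + 2 - m = 2" by simp_all
    have "sidki_s (Suc k + 2) 3 = four_block_mat (sidki_s (k + 2) 2)
        (0\<^sub>m (2 ^ (Suc k + 2 - 3)) (2 ^ (Suc k + 2 - 3))) (1\<^sub>m (2 ^ (Suc k + 2 - 3))) (sidki_s (k + 2) 2)"
      using Suc.hyps by (simp add: sidki_s.simps[of "Suc (Suc (Suc k))"] Let_def)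
    moreover have "acts_by (t_sig j) (t_list k) (sidki_s (k + 2) 2)"
      using Suc.IH[of j] Suc.prems 2 e by simp
    ultimately show ?thesis
      unfolding e list using 2 Suc.prems Suc.hyps
      by (auto intro!: acts_by_double_braided ys h sig_braid simp: length_t_list)
  next
    case 3
    with Suc.prems m_ge have e: "3 < j + Suc k + 2 - m" "j + Suc k + 2 - m - 1 = j + k + 2 - m"
      by simp_all
    then have "sidki_s (Suc k + 2) (j + Suc k + 2 - m) = four_block_mat (sidki_s (k + 2) (j + k + 2 - m))
        (0\<^sub>m (2 ^ (Suc k + 2 - 3)) (2 ^ (Suc k + 2 - 3)))
        (0\<^sub>m (2 ^ (Suc k + 2 - 3)) (2 ^ (Suc k + 2 - 3))) (sidki_s (k + 2) (j + k + 2 - m))"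
      using Suc.hyps by (simp add: sidki_s.simps[of "Suc (Suc (Suc k))"] Let_def)
    moreover have "acts_by (t_sig j) (t_list k) (sidki_s (k + 2) (j + k + 2 - m))"
      using Suc.IH[of j] Suc.prems 3 by simp
    ultimately show ?thesis
      unfolding list using 3 Suc.prems Suc.hyps
      by (auto intro!: acts_by_double_intertwined ys h sig_commute simp: length_t_list)
  qed
qed

text \<open>Before the doubling by \<open>\<sigma>\<^sub>2\<close>, all \<open>\<sigma>\<^sub>j\<close> involved commute with \<open>\<sigma>\<^sub>1\<close>, which fixes \<open>w\<close>.\<close>

lemma sig1_acts_trivially:
  assumes "k \<le> m - 3"
  shows "acts_by (t_sig 1) (t_list k) (1\<^sub>m (2 ^ k))"
  using assms
proof (induction k)
  case 0
  have "1\<^sub>m 1 = mat 1 1 (\<lambda>_. 1 :: coeff_ring)" by (intro eq_matI) auto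
  then show ?case
    using acts_by_singleton[of t_w "t_sig 1" 1] w_mult_sig1 by (simp add: T_elems tscal_simps)
next
  case (Suc k)
  have "acts_by (t_sig 1) (double (t_list k) (t_sig (m - Suc k)))
     (four_block_mat (1\<^sub>m (2 ^ k)) (0\<^sub>m (2 ^ k) (2 ^ k)) (0\<^sub>m (2 ^ k) (2 ^ k)) (1\<^sub>m (2 ^ k)))"
    using Suc m_ge
    by (intro acts_by_double_intertwined[where g' = "t_sig 1"] T_t_list T_elems sig_commute Suc.IH)
      (auto simp: length_t_list)
  then show ?case by (simp add: mult_2)
qed

lemma sig1_acts: "acts_by (t_sig 1) (t_list (m - 2)) (sidki_s m 1)"
proof -
  have e: "m - 2 = Suc (m - 3)" "m - Suc (m - 3) = 2" using m_ge by auto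
  have "acts_by (t_sig 1) (double (t_list (m - 3)) (t_sig 2)) (sidki_s m 1)"
    unfolding sidki_s_1[OF m_ge] using m_ge
    by (intro acts_by_double_braided T_t_list T_elems sig_braid sig1_acts_trivially)
      (auto simp: length_t_list)
  then show ?thesis unfolding e(1) t_list.simps(2) e(2) .
qed

lemma block_diagonal_inverse:
  fixes M N :: "coeff_ring mat"
  assumes "M \<in> carrier_mat n n" "N \<in> carrier_mat n n" "M * N = 1\<^sub>m n" "N * M = 1\<^sub>m n"
  shows "four_block_mat M (0\<^sub>m n n) (0\<^sub>m n n) N * four_block_mat N (0\<^sub>m n n) (0\<^sub>m n n) M = 1\<^sub>m (n + n)"
  by (subst mult_four_block_mat[of _ n n _ n _ n _ _ n _ n]) (use assms in simp_all)

lemma ring_mat_inverse_eq: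
  assumes "M \<in> carrier_mat n n" "N \<in> carrier_mat n n" "M * N = 1\<^sub>m n" "N * M = 1\<^sub>m n"
  shows "inv\<^bsub>ring_mat TYPE(coeff_ring) n ()\<^esub> M = N"
proof -
  interpret R: ring "ring_mat TYPE(coeff_ring) n ()" by (rule ring_mat)
  show ?thesis by (rule R.inv_char) (use assms in \<open>simp_all add: ring_mat_def\<close>)
qed

text \<open>The inverse is carried along, since doubling exchanges \<open>a\<close> with its inverse on the second
  half.\<close>

lemma a_acts:
  assumes "1 \<le> k" "k \<le> m - 2"
  shows "acts_by t_a (t_list k) (sidki_a (k + 2)) \<and>
    (\<exists>N. acts_by t_ainv (t_list k) N \<and> sidki_a (k + 2) * N = 1\<^sub>m (2 ^ k) \<and>
      N * sidki_a (k + 2) = 1\<^sub>m (2 ^ k))"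
  using assms
proof (induction k rule: nat_induct_at_least)
  case base
  let ?M = "\<lambda>c. mat 1 1 (\<lambda>_. c) :: coeff_ring mat" and ?h = "t_sig (m - 1)"
  let ?N = "four_block_mat (?M cr_alphainv) (0\<^sub>m 1 1) (0\<^sub>m 1 1) (?M cr_alpha)"
  have w: "acts_by t_a [t_w] (?M cr_alpha)" "acts_by t_ainv [t_w] (?M cr_alphainv)"
    by (intro acts_by_singleton w_mult_a w_mult_ainv T_elems)+
  have "acts_by t_a (double [t_w] ?h) (sidki_a 3)"
    unfolding sidki_a_3 using m_ge
    by (intro acts_by_double_intertwined[where g' = t_ainv] w sig_a) (auto simp: T_elems)
  moreover have "acts_by t_ainv (double [t_w] ?h) ?N"
    using m_ge by (intro acts_by_double_intertwined[where g' = t_a] w sig_a) (auto simp: T_elems)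
  moreover have "?M c * ?M d = ?M (c * d)" for c d
    by (intro eq_matI) (auto simp: scalar_prod_def)
  then have "?M cr_alpha * ?M cr_alphainv = 1\<^sub>m 1" "?M cr_alphainv * ?M cr_alpha = 1\<^sub>m 1"
    by (auto simp: cr_alpha_inverse cr_alphainv_inverse)
  then have "sidki_a 3 * ?N = 1\<^sub>m 2" "?N * sidki_a 3 = 1\<^sub>m 2"
    unfolding sidki_a_3 using block_diagonal_inverse[of "?M cr_alpha" 1 "?M cr_alphainv"]
      block_diagonal_inverse[of "?M cr_alphainv" 1 "?M cr_alpha"] by (simp_all add: numeral_2_eq_2)
  ultimately show ?case by (auto simp: numeral_3_eq_3)
next
  case (Suc k)
  let ?n = "2 ^ k :: nat" and ?M = "sidki_a (k + 2)" and ?h = "t_sig (m - Suc k)"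
  from Suc obtain N where M: "acts_by t_a (t_list k) ?M" and N: "acts_by t_ainv (t_list k) N"
    and MN: "?M * N = 1\<^sub>m ?n" "N * ?M = 1\<^sub>m ?n" by auto
  have car: "?M \<in> carrier_mat ?n ?n" "N \<in> carrier_mat ?n ?n"
    using acts_by_length[OF M] acts_by_length[OF N] by (simp_all add: length_t_list)
  let ?Z = "0\<^sub>m ?n ?n"
  have a: "sidki_a (Suc k + 2) = four_block_mat ?M ?Z ?Z N"
    using Suc.hyps by (simp add: sidki_a.simps[of "Suc (Suc (Suc k))"] Let_def
        ring_mat_inverse_eq[OF car MN, simplified])
  have "acts_by t_a (t_list (Suc k)) (four_block_mat ?M ?Z ?Z N)"
    unfolding t_list.simps(2) using Suc.prems m_ge
    by (intro acts_by_double_intertwined[where g' = t_ainv] T_t_list T_elems M N sig_a) (auto simp: length_t_list)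
  moreover have "acts_by t_ainv (t_list (Suc k)) (four_block_mat N ?Z ?Z ?M)"
    unfolding t_list.simps(2) using Suc.prems m_ge
    by (intro acts_by_double_intertwined[where g' = t_a] T_t_list T_elems M N sig_a) (auto simp: length_t_list)
  moreover have "four_block_mat ?M ?Z ?Z N * four_block_mat N ?Z ?Z ?M = 1\<^sub>m (2 ^ Suc k)"
    "four_block_mat N ?Z ?Z ?M * four_block_mat ?M ?Z ?Z N = 1\<^sub>m (2 ^ Suc k)"
    using block_diagonal_inverse[OF car MN] block_diagonal_inverse[OF car(2,1) MN(2,1)]
    by (simp_all add: mult_2)
  ultimately show ?case unfolding a by blast
qed

end

section \<open>Linear independence\<close>

text \<open>Operators are compared as functions; evaluating sums at points by default would destroy the
  terms to which linearity applies.\<close>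

declare plus_fun_apply [simp del] zero_fun_apply [simp del]

lemmas fock_apply = fun_eq_iff plus_fun_apply zero_fun_apply

lemma cr_two: "(2 :: coeff_ring) = 0"
  using cr_add_self[of 1] by simp

text \<open>The Fock space: the index sets label the monomials of an exterior algebra on the basis
  vectors, and \<open>raise\<close> and \<open>lower\<close> are exterior multiplication and interior derivative. Functions of
  infinite support are harmless, because each operator reads only finitely many values.\<close>

type_synonym fock = "nat set \<Rightarrow> coeff_ring"

definition smul :: "coeff_ring \<Rightarrow> fock \<Rightarrow> fock" where
  "smul c f = (\<lambda>S. c * f S)"

definition raise :: "nat \<Rightarrow> fock \<Rightarrow> fock" where
  "raise i f = (\<lambda>S. if i \<in> S then f (S - {i}) else 0)"

definition lower :: "nat \<Rightarrow> fock \<Rightarrow> fock" where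
  "lower i f = (\<lambda>S. if i \<in> S then 0 else f (insert i S))"

definition contract :: "nat \<Rightarrow> (nat \<Rightarrow> coeff_ring) \<Rightarrow> fock \<Rightarrow> fock" where
  "contract m \<phi> f = (\<Sum>k\<le>m. smul (\<phi> k) (lower k f))"

text \<open>An upper triangular bilinear form \<open>\<beta>\<close> with \<open>\<beta>(x, x) = q(x)\<close>. Chevalley's action of a vector
  on the exterior algebra, exterior multiplication plus contraction with \<open>\<beta>\<close>, squares to \<open>q\<close>.\<close>

definition polar_half :: "nat \<Rightarrow> nat \<Rightarrow> coeff_ring" where
  "polar_half i k = (if k = i then if i = 0 then 1 else cr_sinv\<^sup>2 else if i < k then 1 else 0)"

definition fock_gen :: "nat \<Rightarrow> nat \<Rightarrow> fock \<Rightarrow> fock" where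
  "fock_gen m i f = raise i f + contract m (polar_half i) f"

definition vacuum :: fock where
  "vacuum S = (if S = {} then 1 else 0)"

lemma fock_add_self: "(f :: fock) + f = 0"
  by (simp add: fock_apply cr_two)

lemma fock_add_self_left: "(f :: fock) + (f + g) = g"
  by (simp add: fock_apply cr_two)

lemma fock_cancel: "f + g = h \<Longrightarrow> f = g + h" for f g h :: fock
  by (metis add.commute add.left_commute add.right_neutral fock_add_self)

lemma smul_simps:
  "smul c (f + g) = smul c f + smul c g" "smul (c + d) f = smul c f + smul d f"
  "smul c (smul d f) = smul (c * d) f" "smul 0 f = 0" "smul c 0 = 0" "smul 1 f = f"
  by (simp_all add: smul_def fock_apply algebra_simps)

lemma smul_sum: "smul c (sum f A) = (\<Sum>i\<in>A. smul c (f i))"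
  by (induction A rule: infinite_finite_induct) (simp_all add: smul_simps)

lemma sum_smul: "smul (sum c A) f = (\<Sum>i\<in>A. smul (c i) f)"
  by (induction A rule: infinite_finite_induct) (simp_all add: smul_simps)

definition fock_linear :: "(fock \<Rightarrow> fock) \<Rightarrow> bool" where
  "fock_linear h \<longleftrightarrow> (\<forall>f g. h (f + g) = h f + h g) \<and> (\<forall>c f. h (smul c f) = smul c (h f))"

lemma fock_linearD:
  assumes "fock_linear h"
  shows "h (f + g) = h f + h g" "h (smul c f) = smul c (h f)" "h 0 = 0"
    "h (sum k A) = (\<Sum>i\<in>A. h (k i))"
proof -
  show add: "h (f + g) = h f + h g" and sm: "h (smul c f) = smul c (h f)" for f g c
    using assms by (simp_all add: fock_linear_def)
  show 0: "h 0 = 0" using sm[of 0 0] by (simp add: smul_simps)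
  show "h (sum k A) = (\<Sum>i\<in>A. h (k i))"
    by (induction A rule: infinite_finite_induct) (simp_all add: 0 add)
qed

lemma fock_linear_add: "fock_linear h \<Longrightarrow> fock_linear k \<Longrightarrow> fock_linear (\<lambda>f. h f + k f)"
  by (simp add: fock_linear_def smul_simps ac_simps)

lemma fock_linear_smul: "fock_linear h \<Longrightarrow> fock_linear (\<lambda>f. smul c (h f))"
  by (simp add: fock_linear_def smul_simps mult.commute)

lemma fock_linear_sum: "(\<And>i. fock_linear (h i)) \<Longrightarrow> fock_linear (\<lambda>f. \<Sum>i\<in>A. h i f)"
  by (simp add: fock_linear_def sum.distrib smul_sum)

lemma fock_linear_raise: "fock_linear (raise i)"
  and fock_linear_lower: "fock_linear (lower i)"
  by (auto simp: fock_linear_def raise_def lower_def smul_def fock_apply)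

lemma fock_linear_contract: "fock_linear (contract m \<phi>)"
  unfolding contract_def by (intro fock_linear_sum fock_linear_smul fock_linear_lower)

lemma fock_linear_gen: "fock_linear (fock_gen m i)"
  unfolding fock_gen_def by (intro fock_linear_add fock_linear_raise fock_linear_contract)

lemmas raise_linear = fock_linearD[OF fock_linear_raise]
lemmas lower_linear = fock_linearD[OF fock_linear_lower]
lemmas contract_linear = fock_linearD[OF fock_linear_contract]
lemmas gen_linear = fock_linearD[OF fock_linear_gen]

lemma raise_commute: "raise i (raise j f) = raise j (raise i f)"
proof (rule ext)
  fix S
  have "S - {i} - {j} = S - {j} - {i}" by auto
  then show "raise i (raise j f) S = raise j (raise i f) S" by (auto simp: raise_def)
qed

lemma raise_square: "raise i (raise i f) = 0"
  by (auto simp: raise_def fock_apply)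

lemma lower_commute: "lower i (lower j f) = lower j (lower i f)"
  by (auto simp: lower_def fock_apply insert_commute)

lemma lower_square: "lower i (lower i f) = 0"
  by (auto simp: lower_def fock_apply)

lemma lower_raise: "lower i (raise j f) = raise j (lower i f) + (if i = j then f else 0)"
proof (rule ext)
  fix S
  show "lower i (raise j f) S = (raise j (lower i f) + (if i = j then f else 0)) S"
  proof (cases "i = j")
    case True
    then show ?thesis by (auto simp: lower_def raise_def insert_absorb fock_apply cr_two)
  next
    case False
    then have "insert i S - {j} = insert i (S - {j})" by auto
    with False show ?thesis by (auto simp: lower_def raise_def fock_apply)
  qed
qed

lemma lower_contract: "lower i (contract m \<phi> f) = contract m \<phi> (lower i f)"
  unfolding contract_def by (simp add: lower_linear lower_commute[of i])

lemma contract_commute: "contract m \<phi> (contract m \<chi> f) = contract m \<chi> (contract m \<phi> f)"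
  by (subst (1 4) contract_def) (simp add: contract_linear lower_contract)

lemma contract_raise:
  assumes "i \<le> m"
  shows "contract m \<phi> (raise i f) = raise i (contract m \<phi> f) + smul (\<phi> i) f"
proof -
  have "contract m \<phi> (raise i f) =
      (\<Sum>k\<le>m. smul (\<phi> k) (raise i (lower k f)) + (if k = i then smul (\<phi> k) f else 0))"
    unfolding contract_def
    by (intro sum.cong refl) (auto simp: lower_raise smul_simps)
  also have "\<dots> = raise i (contract m \<phi> f) + smul (\<phi> i) f"
    using assms by (simp add: sum.distrib contract_def raise_linear)
  finally show ?thesis .
qed

text \<open>Separates the squares from the mixed terms in the expansion of the square of a sum of
  noncommuting terms.\<close>

lemma double_sum_symmetrize:
  "(\<Sum>j\<le>m. \<Sum>i\<le>m. g i j) = (\<Sum>i\<le>m. g i i) + (\<Sum>j\<le>m. \<Sum>i<j. g i j + g j i)"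
  for g :: "nat \<Rightarrow> nat \<Rightarrow> 'a :: comm_monoid_add"
proof (induction m)
  case (Suc m)
  have "(\<Sum>j\<le>Suc m. \<Sum>i\<le>Suc m. g i j) = (\<Sum>j\<le>m. \<Sum>i\<le>m. g i j)
      + (\<Sum>j\<le>m. g (Suc m) j) + ((\<Sum>i\<le>m. g i (Suc m)) + g (Suc m) (Suc m))"
    by (simp add: sum.distrib ac_simps)
  then show ?case
    unfolding Suc by (simp add: lessThan_Suc_atMost sum.distrib ac_simps)
qed simp

lemma contract_square: "contract m \<phi> (contract m \<phi> f) = 0"
proof -
  have "contract m \<phi> (contract m \<phi> f) =
      (\<Sum>j\<le>m. \<Sum>i\<le>m. smul (\<phi> j * \<phi> i) (lower j (lower i f)))"
    by (simp add: contract_def lower_linear smul_sum smul_simps)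
  also have "\<dots> = 0"
    unfolding double_sum_symmetrize
    by (simp add: lower_square smul_simps lower_commute mult.commute fock_add_self)
  finally show ?thesis .
qed

lemma fock_gen_product:
  "fock_gen m i (fock_gen m j f) = raise i (raise j f) + raise i (contract m (polar_half j) f)
    + contract m (polar_half i) (raise j f)
    + contract m (polar_half i) (contract m (polar_half j) f)"
  by (simp add: fock_gen_def raise_linear contract_linear ac_simps)

lemma fock_gen_square:
  assumes "i \<le> m"
  shows "fock_gen m i (fock_gen m i f) = smul (if i = 0 then 1 else cr_sinv\<^sup>2) f"
  unfolding fock_gen_product raise_square contract_square contract_raise[OF assms]
  by (simp add: fock_add_self_left) (simp add: polar_half_def)

lemma fock_gen_anticommute:
  assumes "i \<le> m" "j \<le> m" "i < j"
  shows "fock_gen m i (fock_gen m j f) + fock_gen m j (fock_gen m i f) = f"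
proof -
  have "fock_gen m i (fock_gen m j f) + fock_gen m j (fock_gen m i f) =
      smul (polar_half i j) f + smul (polar_half j i) f"
    unfolding fock_gen_product raise_commute[of j i] contract_commute[of m "polar_half j" "polar_half i"]
      contract_raise[OF assms(1)] contract_raise[OF assms(2)]
    by (simp add: fock_apply) (simp add: algebra_simps cr_two)
  then show ?thesis using assms(3) by (simp add: polar_half_def smul_simps)
qed

text \<open>Tensors act from the right: the first letter of a word acts first.\<close>

definition word_act :: "nat \<Rightarrow> nc_word \<Rightarrow> fock \<Rightarrow> fock" where
  "word_act m w f = foldl (\<lambda>g i. fock_gen m i g) f (letters w)"

definition tensor_act :: "nat \<Rightarrow> tensor \<Rightarrow> fock \<Rightarrow> fock" where
  "tensor_act m p f = (\<Sum>w\<in>Poly_Mapping.keys p. smul (Poly_Mapping.lookup p w) (word_act m w f))"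

lemma fock_linear_word_act: "fock_linear (word_act m w)"
proof -
  have "fock_linear (\<lambda>f. foldl (\<lambda>g i. fock_gen m i g) f xs)" for xs
    by (induction xs rule: rev_induct) (auto simp: fock_linear_def gen_linear)
  then show ?thesis by (simp add: word_act_def[abs_def])
qed

lemma fock_linear_tensor_act: "fock_linear (tensor_act m p)"
  unfolding tensor_act_def by (intro fock_linear_sum fock_linear_smul fock_linear_word_act)

lemmas act_linear = fock_linearD[OF fock_linear_tensor_act]

lemma tensor_act_superset:
  assumes "finite K" "Poly_Mapping.keys p \<subseteq> K"
  shows "tensor_act m p f = (\<Sum>w\<in>K. smul (Poly_Mapping.lookup p w) (word_act m w f))"
  unfolding tensor_act_def using assms
  by (intro sum.mono_neutral_left) (auto simp: in_keys_iff smul_simps)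

lemma tensor_act_add: "tensor_act m (p + q) f = tensor_act m p f + tensor_act m q f"
proof -
  let ?K = "Poly_Mapping.keys p \<union> Poly_Mapping.keys q"
  have "Poly_Mapping.keys (p + q) \<subseteq> ?K" by (rule keys_add)
  then show ?thesis
    by (simp add: tensor_act_superset[of ?K] lookup_add smul_simps sum.distrib)
qed

lemma tensor_act_single: "tensor_act m (Poly_Mapping.single w c) f = smul c (word_act m w f)"
  by (subst tensor_act_superset[of "{w}"]) (auto simp: when_def)

lemma tensor_act_mult: "tensor_act m (p * q) f = tensor_act m q (tensor_act m p f)"
proof (induction p rule: tensor_induct)
  case (single w c)
  show ?case
  proof (induction q rule: tensor_induct)
    case (single v d)
    show ?case
      by (simp add: mult_single tensor_act_single fock_linearD[OF fock_linear_word_act] smul_simps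
          mult.commute) (simp add: word_act_def plus_nc_word_def)
  qed (simp add: distrib_left tensor_act_add)
qed (simp add: distrib_right tensor_act_add act_linear)

lemma tensor_act_zero: "tensor_act m 0 f = 0"
  by (simp add: tensor_act_def)

lemma tensor_act_sum: "tensor_act m (sum p A) f = (\<Sum>i\<in>A. tensor_act m (p i) f)"
  by (induction A rule: infinite_finite_induct) (simp_all add: tensor_act_zero tensor_act_add)

lemma tensor_act_tscal: "tensor_act m (tscal c) f = smul c f"
  by (simp add: tscal_def tensor_act_single word_act_def zero_nc_word_def)

lemma tensor_act_tgen: "tensor_act m (tgen i) f = fock_gen m i f"
  by (simp add: tgen_def tensor_act_single word_act_def smul_simps)

lemmas tensor_act_simps = tensor_act_add tensor_act_mult tensor_act_tscal tensor_act_tgen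

lemma tensor_act_tvec_square: "tensor_act m (tvec m x * tvec m x) f = smul (qform m x) f"
proof -
  let ?L = "fock_gen m"
  have "tensor_act m (tvec m x * tvec m x) f =
      (\<Sum>j\<le>m. \<Sum>i\<le>m. smul (x j * x i) (?L j (?L i f)))"
    by (simp add: tvec_def tensor_act_simps tensor_act_sum gen_linear smul_sum smul_simps)
  also have "\<dots> = (\<Sum>i\<le>m. smul ((x i)\<^sup>2 * (if i = 0 then 1 else cr_sinv\<^sup>2)) f)
      + (\<Sum>j\<le>m. \<Sum>i<j. smul (x i * x j) f)"
    unfolding double_sum_symmetrize
  proof (intro arg_cong2[where f = "(+)"] sum.cong refl)
    fix i assume "i \<in> {..m}"
    then show "smul (x i * x i) (?L i (?L i f)) = smul ((x i)\<^sup>2 * (if i = 0 then 1 else cr_sinv\<^sup>2)) f"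
      by (simp add: fock_gen_square smul_simps power2_eq_square)
  next
    fix j i assume "j \<in> {..m}" "i \<in> {..<j}"
    then have "?L i (?L j f) + ?L j (?L i f) = f" by (intro fock_gen_anticommute) auto
    then show "smul (x j * x i) (?L j (?L i f)) + smul (x i * x j) (?L i (?L j f)) = smul (x i * x j) f"
      by (simp add: mult.commute[of "x j"] smul_simps(1)[symmetric] add.commute)
  qed simp_all
  also have "\<dots> = smul (qform m x) f"
    by (simp add: qform_def smul_simps sum_smul)
  finally show ?thesis .
qed

lemma lower_vacuum: "lower i vacuum = 0"
  by (auto simp: lower_def vacuum_def fock_apply)

lemma lower_fock_gen: "lower k (fock_gen m i f) = fock_gen m i (lower k f) + (if i = k then f else 0)"
  by (simp add: fock_gen_def lower_linear lower_raise lower_contract ac_simps)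

text \<open>The contraction with the linear form that is \<open>1\<close> on \<open>v\<^sub>k\<close> for \<open>j < k \<le> m\<close> and \<open>0\<close> on the
  other basis vectors; among the vectors \<open>v\<^sub>i + v\<^sub>i\<^sub>+\<^sub>1\<close> with \<open>i < m\<close> it detects precisely the one
  with \<open>i = j\<close>.\<close>

definition lower_above :: "nat \<Rightarrow> nat \<Rightarrow> fock \<Rightarrow> fock" where
  "lower_above m j f = (\<Sum>k\<in>{j<..m}. lower k f)"

lemma fock_linear_lower_above: "fock_linear (lower_above m j)"
  unfolding lower_above_def by (intro fock_linear_sum fock_linear_lower)

lemmas lower_above_linear = fock_linearD[OF fock_linear_lower_above]

lemma lower_above_vacuum: "lower_above m j vacuum = 0"
  by (simp add: lower_above_def lower_vacuum)

lemma lower_above_fock_gen: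
  "i \<le> m \<Longrightarrow> lower_above m j (fock_gen m i f) = fock_gen m i (lower_above m j f) + (if j < i then f else 0)"
  by (simp add: lower_above_def lower_fock_gen sum.distrib gen_linear)

lemma lower_above_sig:
  assumes "i < m"
  shows "lower_above m j (tensor_act m (t_sig i) f) =
    tensor_act m (t_sig i) (lower_above m j f) + (if i = j then fock_gen m 0 f else 0)"
  using assms
  by (simp add: t_sig_def tensor_act_simps lower_above_linear lower_above_fock_gen)
    (auto simp: fock_apply algebra_simps cr_two)

context clifford
begin

text \<open>The tensors that act as zero form an ideal which contains the defining relations.\<close>

lemma ideal_annihilates: "p \<in> I \<Longrightarrow> tensor_act m p f = 0"
proof -
  let ?J = "{p \<in> T. \<forall>f. tensor_act m p f = 0}"
  have "ideal ?J (tensor_alg m)"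
  proof (rule idealI)
    show "subgroup ?J (add_monoid (tensor_alg m))"
    proof
      fix p assume "p \<in> ?J"
      then have "inv\<^bsub>add_monoid (tensor_alg m)\<^esub> p = p"
        using T_minus[of p] by (simp add: a_inv_def)
      with \<open>p \<in> ?J\<close> show "inv\<^bsub>add_monoid (tensor_alg m)\<^esub> p \<in> ?J" by simp
    qed (auto simp: tensor_ops tensor_act_add tensor_act_zero T_0 T_add)
  qed (auto simp: tensor_ops tensor_act_mult act_linear T_mult intro: ring_tensor_alg)
  moreover have "{tvec m x * tvec m x - tscal (qform m x) | x. x \<in> Vmod m} \<subseteq> ?J"
    by (auto simp: tensor_diff tensor_act_add tensor_act_tvec_square tensor_act_tscal
        fock_add_self intro!: T_intros)
  ultimately have "I \<subseteq> ?J"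
    unfolding cliff_ideal_def by (rule TR.genideal_minimal)
  then show "p \<in> I \<Longrightarrow> tensor_act m p f = 0" by auto
qed

lemma cong_tensor_act:
  assumes "p \<simeq>\<^sub>C q"
  shows "tensor_act m p f = tensor_act m q f"
proof -
  have "p + q \<in> I" using assms cl_of_eq_iff[of p q] by (simp add: cong_def)
  then have "tensor_act m p f + tensor_act m q f = 0"
    using ideal_annihilates by (simp add: tensor_act_add[symmetric])
  then show ?thesis using fock_cancel[of "tensor_act m p f" "tensor_act m q f" 0] by simp
qed

text \<open>Of the four terms of \<open>w\<close> only \<open>\<alpha> u v\<^sub>1\<close> reaches the monomial of \<open>u\<close> and \<open>v\<^sub>1\<close>.\<close>

lemma w_act_coefficient: "tensor_act m t_w vacuum {0, 1} = cr_alpha"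
proof -
  have gen_vac: "fock_gen m i vacuum = raise i vacuum" for i
    by (simp add: fock_gen_def contract_def lower_vacuum smul_simps)
  have con_vac: "contract m \<phi> vacuum = 0" for \<phi>
    by (simp add: contract_def lower_vacuum smul_simps)
  have gen: "fock_gen m i (raise j vacuum) = raise i (raise j vacuum) + smul (polar_half i j) vacuum"
    if "j \<le> m" for i j
    using that by (simp add: fock_gen_def contract_raise con_vac raise_linear)
  show ?thesis
    using m_ge unfolding t_w_def
    by (simp add: tensor_act_simps gen_vac gen gen_linear)
      (auto simp: smul_def raise_def vacuum_def plus_fun_apply)
qed

lemma lower_above_t_list:
  assumes "2 \<le> j" "j < m - k" "y \<in> set (t_list k)"
  shows "lower_above m j (tensor_act m y vacuum) = 0"
  using assms
proof (induction k arbitrary: y)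
  case 0
  then show ?case using m_ge
    by (simp add: t_w_def tensor_act_simps lower_above_linear lower_above_fock_gen
        lower_above_vacuum gen_linear smul_simps)
next
  case (Suc k)
  then consider "y \<in> set (t_list k)" | z where "z \<in> set (t_list k)" "y = z * t_sig (m - Suc k)"
    by (auto simp: double_def)
  then show ?case
  proof cases
    case 2
    with Suc show ?thesis by (simp add: tensor_act_mult lower_above_sig act_linear)
  qed (use Suc in auto)
qed

text \<open>Contracting a relation \<open>x + x' \<sigma>\<^sub>j = 0\<close> gives \<open>x' u = 0\<close>, and \<open>u\<close> is its own inverse; so the
  two halves vanish separately.\<close>

lemma t_list_independent:
  assumes "k \<le> m - 2" "tensor_act m (lincomb c (t_list k)) vacuum = 0" "i < 2 ^ k"
  shows "c i = 0"
  using assms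
proof (induction k arbitrary: c i)
  case 0
  then have "smul (c 0) (tensor_act m t_w vacuum) {0, 1} = 0"
    by (simp add: lincomb_def tensor_act_simps act_linear zero_fun_apply)
  then have "c 0 * cr_alpha = 0" using w_act_coefficient by (simp add: smul_def)
  then have "c 0 * (cr_alpha * cr_alphainv) = 0" by (simp add: mult.assoc[symmetric])
  with 0 show ?case by (simp add: cr_alpha_inverse)
next
  case (Suc k)
  let ?ys = "t_list k" and ?j = "m - Suc k"
  let ?d = "\<lambda>i. c (2 ^ k + i)"
  let ?x = "tensor_act m (lincomb c ?ys) vacuum" and ?x' = "tensor_act m (lincomb ?d ?ys) vacuum"
  have j: "2 \<le> ?j" "?j < m - k" using Suc.prems by auto
  have killed: "lower_above m ?j (tensor_act m (lincomb e ?ys) vacuum) = 0" for e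
    unfolding lincomb_def tensor_act_sum lower_above_linear
    using j by (intro sum.neutral) (auto simp: tensor_act_simps act_linear lower_above_linear
        lower_above_t_list smul_simps)
  have eq: "?x + tensor_act m (t_sig ?j) ?x' = 0"
    using Suc.prems(2) by (simp add: lincomb_double tensor_act_simps length_t_list)
  have "lower_above m ?j (?x + tensor_act m (t_sig ?j) ?x') = fock_gen m 0 ?x'"
    using j by (simp add: lower_above_linear killed lower_above_sig act_linear)
  then have "fock_gen m 0 ?x' = 0" unfolding eq by (simp add: lower_above_linear)
  then have "fock_gen m 0 (fock_gen m 0 ?x') = 0" by (simp add: gen_linear)
  then have x': "?x' = 0" by (simp add: fock_gen_square smul_simps)
  then have "?x = 0" using eq by (simp add: act_linear)
  show ?case
  proof (cases "i < 2 ^ k")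
    case True
    then show ?thesis using Suc \<open>?x = 0\<close> by simp
  next
    case False
    then have "?d (i - 2 ^ k) = 0" using Suc.prems x' by (intro Suc.IH) auto
    with False show ?thesis by simp
  qed
qed

end

section \<open>Words in a presented group\<close>

lemma pres_eq_append: "pres_eq X Rel v w \<Longrightarrow> pres_eq X Rel (x @ v @ y) (x @ w @ y)"
proof (induction rule: pres_eq.induct)
  case (refl v)
  show ?case by (rule pres_eq.refl)
next
  case (sym v w)
  from sym.IH show ?case by (rule pres_eq.sym)
next
  case (trans v w z)
  from trans.IH show ?case by (rule pres_eq.trans)
next
  case (cancel g v b w)
  then show ?case using pres_eq.cancel[of g X Rel "x @ v" b "w @ y"] by simp
next
  case (rel l r v w)
  then show ?case using pres_eq.rel[of l r Rel X "x @ v" "w @ y"] by simp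
qed

lemma pres_eq_append2:
  assumes "pres_eq X Rel v v'" "pres_eq X Rel w w'"
  shows "pres_eq X Rel (v @ w) (v' @ w')"
proof (rule pres_eq.trans)
  show "pres_eq X Rel (v @ w) (v' @ w)" using pres_eq_append[OF assms(1), of "[]" w] by simp
  show "pres_eq X Rel (v' @ w) (v' @ w')" using pres_eq_append[OF assms(2), of v' "[]"] by simp
qed

lemma pres_class_eq:
  assumes "pres_eq X Rel v w"
  shows "pres_class X Rel v = pres_class X Rel w"
proof -
  have "pres_eq X Rel v z \<longleftrightarrow> pres_eq X Rel w z" for z
    using pres_eq.trans[OF assms, of z] pres_eq.trans[OF pres_eq.sym[OF assms], of z] by argo
  then show ?thesis by (simp add: pres_class_def)
qed

lemma pres_class_mult:
  assumes "v \<in> gwords X" "w \<in> gwords X"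
  shows "pres_class X Rel v \<otimes>\<^bsub>pres_group X Rel\<^esub> pres_class X Rel w = pres_class X Rel (v @ w)"
proof -
  have "v \<in> pres_class X Rel v" "w \<in> pres_class X Rel w"
    using assms by (auto simp: pres_class_def intro: pres_eq.refl)
  moreover have "pres_class X Rel (v' @ w') = pres_class X Rel (v @ w)"
    if "v' \<in> pres_class X Rel v" "w' \<in> pres_class X Rel w" for v' w'
    using that by (intro pres_class_eq pres_eq_append2 pres_eq.sym[of _ _ v] pres_eq.sym[of _ _ w])
      (simp_all add: pres_class_def)
  ultimately have "(\<Union>v' \<in> pres_class X Rel v. \<Union>w' \<in> pres_class X Rel w. pres_class X Rel (v' @ w')) =
      pres_class X Rel (v @ w)"
    by blast
  then show ?thesis by (simp add: pres_group_def)
qed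

section \<open>Invariance\<close>

locale clifford_action = clifford +
  fixes \<psi> :: "y_gen gword set \<Rightarrow> cliff"
  assumes psi: "is_psi m \<psi>"
begin

abbreviation "gens \<equiv> gwords (y_gens m)"
abbreviation "cls \<equiv> pres_class (y_gens m) (y_rels m)"

lemma psi_hom: "\<psi> \<in> hom (y_group m) (units_of (Cl m))"
  using psi by (simp add: is_psi_def)

lemma cls_carrier: "w \<in> gens \<Longrightarrow> cls w \<in> carrier (y_group m)"
  by (simp add: y_group_def pres_group_def)

lemma psi_unit:
  assumes "w \<in> gens"
  shows "\<psi> (cls w) \<in> Units (Cl m)" "\<psi> (cls w) \<in> carrier (Cl m)"
proof -
  have "\<psi> (cls w) \<in> carrier (units_of (Cl m))"
    using psi_hom cls_carrier[OF assms] by (rule hom_in_carrier)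
  then show "\<psi> (cls w) \<in> Units (Cl m)" by (simp add: units_of_carrier)
  then show "\<psi> (cls w) \<in> carrier (Cl m)" by (rule CH.S.Units_closed)
qed

lemma psi_append:
  assumes "v \<in> gens" "w \<in> gens"
  shows "\<psi> (cls (v @ w)) = \<psi> (cls v) \<otimes>\<^bsub>Cl m\<^esub> \<psi> (cls w)"
proof -
  have "\<psi> (cls v \<otimes>\<^bsub>y_group m\<^esub> cls w) = \<psi> (cls v) \<otimes>\<^bsub>units_of (Cl m)\<^esub> \<psi> (cls w)"
    by (rule hom_mult[OF psi_hom cls_carrier[OF assms(1)] cls_carrier[OF assms(2)]])
  then show ?thesis using pres_class_mult[OF assms] by (simp add: y_group_def units_of_mult)
qed

text \<open>A word that equals its own square is mapped to an idempotent unit, that is, to \<open>1\<close>. This treats the neutral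
  element without showing first that the presented structure is a group.\<close>

lemma psi_idempotent:
  assumes "w \<in> gens" "pres_eq (y_gens m) (y_rels m) (w @ w) w"
  shows "\<psi> (cls w) = \<one>\<^bsub>Cl m\<^esub>"
proof -
  let ?g = "\<psi> (cls w)"
  have "?g \<otimes>\<^bsub>Cl m\<^esub> ?g = ?g"
    using psi_append[OF assms(1,1)] pres_class_eq[OF assms(2)] by simp
  then show ?thesis
    using psi_unit[OF assms(1)] CH.S.Units_l_cancel[of ?g ?g "\<one>\<^bsub>Cl m\<^esub>"] by simp
qed

lemma psi_Nil: "\<psi> (cls []) = \<one>\<^bsub>Cl m\<^esub>"
  using psi_idempotent[of "[]"] pres_eq.refl[of "y_gens m" "y_rels m" "[]"]
  by (simp add: gwords_def)

lemma psi_a: "\<psi> (y_a m) = cl_of m t_a"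
  and psi_s: "1 \<le> i \<Longrightarrow> i < m \<Longrightarrow> \<psi> (y_s m i) = cl_of m (t_sig i)"
  using psi by (simp_all add: is_psi_def t_a_def t_sig_def)

lemma gens_letter: "x \<in> y_gens m \<Longrightarrow> [(b, x)] \<in> gens"
  by (simp add: gwords_def)

lemma gens_perm: "p permutes {1..m} \<Longrightarrow> [(b, Gen_perm p)] \<in> gens"
  by (intro gens_letter) (simp add: y_gens_def sym_group_carrier)

text \<open>The image of the inverse letter is a left inverse of \<open>\<psi> (cls [(True, x)])\<close>, and therefore
  agrees with any right inverse.\<close>

lemma psi_inverse_letter:
  assumes "x \<in> y_gens m" "z \<in> carrier (Cl m)" "\<psi> (cls [(True, x)]) \<otimes>\<^bsub>Cl m\<^esub> z = \<one>\<^bsub>Cl m\<^esub>"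
  shows "\<psi> (cls [(False, x)]) = z"
proof -
  have "pres_eq (y_gens m) (y_rels m) ([(False, x)] @ [(True, x)]) []"
    using pres_eq.cancel[OF assms(1), of "y_rels m" "[]" False "[]"] by simp
  then have "cls ([(False, x)] @ [(True, x)]) = cls []" by (rule pres_class_eq)
  then have "\<psi> (cls [(False, x)]) \<otimes>\<^bsub>Cl m\<^esub> \<psi> (cls [(True, x)]) = \<one>\<^bsub>Cl m\<^esub>"
    using psi_append[OF gens_letter gens_letter, OF assms(1,1), of False True] psi_Nil by simp
  then show ?thesis
    using CH.S.inv_unique[OF _ assms(3)] psi_unit[OF gens_letter[OF assms(1)]] assms(2) by blast
qed

lemma gens_gw_perm: "p permutes {1..m} \<Longrightarrow> gw_perm p \<in> gens"
  unfolding gw_perm_def by (rule gens_perm)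

lemma psi_perm_comp:
  assumes "p permutes {1..m}" "p' permutes {1..m}"
  shows "\<psi> (cls (gw_perm (p \<circ> p'))) = \<psi> (cls (gw_perm p)) \<otimes>\<^bsub>Cl m\<^esub> \<psi> (cls (gw_perm p'))"
proof -
  have "(gw_perm p @ gw_perm p', gw_perm (p \<circ> p')) \<in> y_rels m"
    using assms by (auto simp: y_rels_def sym_group_carrier sym_group_mult)
  then have "pres_eq (y_gens m) (y_rels m) (gw_perm p @ gw_perm p') (gw_perm (p \<circ> p'))"
    using pres_eq.rel[of _ _ "y_rels m" "y_gens m" "[]" "[]"] by simp
  then have "cls (gw_perm (p \<circ> p')) = cls (gw_perm p @ gw_perm p')"
    by (simp add: pres_class_eq)
  then show ?thesis using psi_append[OF gens_gw_perm gens_gw_perm] assms by simp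
qed

lemma psi_perm_id: "\<psi> (cls (gw_perm id)) = \<one>\<^bsub>Cl m\<^esub>"
proof (rule psi_idempotent)
  show "gw_perm id \<in> gens" by (simp add: gw_perm_def gens_perm permutes_id)
  have "(gw_perm id @ gw_perm id, gw_perm (id \<circ> id)) \<in> y_rels m"
    by (auto simp: y_rels_def sym_group_carrier sym_group_mult intro!: exI[of _ id] permutes_id)
  then show "pres_eq (y_gens m) (y_rels m) (gw_perm id @ gw_perm id) (gw_perm id)"
    using pres_eq.rel[of _ _ "y_rels m" "y_gens m" "[]" "[]"] by fastforce
qed

abbreviation basis :: "tensor list" where "basis \<equiv> t_list (m - 2)"

lemma T_basis: "set basis \<subseteq> T"
  using m_ge by (intro T_t_list) auto

lemma X_list_eq: "X_list m \<psi> = map (cl_of m) basis"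
proof -
  have "foldl (\<lambda>xs k. xs @ map (cl_act m \<psi> (y_s m (m - k))) xs) [cl_w m] [1..<Suc n] =
      map (cl_of m) (t_list n)" if "n \<le> m - 2" for n
    using that
  proof (induction n)
    case 0
    then show ?case by (simp add: cl_w_def t_w_def)
  next
    case (Suc n)
    have "cl_act m \<psi> (y_s m (m - Suc n)) (cl_of m y) = cl_of m (y * t_sig (m - Suc n))"
      if "y \<in> set (t_list n)" for y
      using that Suc.prems m_ge T_t_list[of n]
      by (simp add: cl_act_def psi_s cl_of_mult T_elems subset_iff)
    then show ?case using Suc by (simp add: double_def)
  qed
  from this[of "m - 2"] show ?thesis using m_ge by (simp add: X_list_def Suc_diff_Suc numeral_2_eq_2)
qed

lemma cl_lincomb_eq:
  assumes "set ys \<subseteq> T"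
  shows "cl_lincomb m c (map (cl_of m) ys) = cl_of m (lincomb c ys)"
proof -
  have in_T: "tscal (c i) * ys ! i \<in> T" if "i < length ys" for i
    using that assms by (auto intro!: T_intros)
  have "(\<Oplus>\<^bsub>Cl m\<^esub> i \<in> {..<n}. cl_smult m (c i) (map (cl_of m) ys ! i)) =
      cl_of m (\<Sum>i<n. tscal (c i) * ys ! i)" if "n \<le> length ys" for n
    using that
  proof (induction n)
    case 0
    then show ?case by (simp add: cl_of_0)
  next
    case (Suc n)
    have sm: "cl_smult m (c i) (map (cl_of m) ys ! i) = cl_of m (tscal (c i) * ys ! i)"
      if "i < length ys" for i
    proof -
      have "ys ! i \<in> T" using that assms by auto
      then show ?thesis using that cl_of_mult[OF T_tscal] by (simp add: cl_smult_def)
    qed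
    have car: "cl_smult m (c i) (map (cl_of m) ys ! i) \<in> carrier (Cl m)" if "i < length ys" for i
      unfolding sm[OF that] by (intro CH.hom_closed in_T that)
    have "(\<Oplus>\<^bsub>Cl m\<^esub> i \<in> {..<Suc n}. cl_smult m (c i) (map (cl_of m) ys ! i)) =
        cl_smult m (c n) (map (cl_of m) ys ! n) \<oplus>\<^bsub>Cl m\<^esub>
        (\<Oplus>\<^bsub>Cl m\<^esub> i \<in> {..<n}. cl_smult m (c i) (map (cl_of m) ys ! i))"
      unfolding lessThan_Suc using Suc.prems
      by (intro CH.S.finsum_insert) (auto simp del: nth_map intro!: car)
    also have "\<dots> = cl_of m (tscal (c n) * ys ! n) \<oplus>\<^bsub>Cl m\<^esub> cl_of m (\<Sum>i<n. tscal (c i) * ys ! i)"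
      using Suc sm[of n] by simp
    also have "\<dots> = cl_of m (\<Sum>i<Suc n. tscal (c i) * ys ! i)"
      using Suc.prems by (subst cl_of_add[symmetric]) (auto simp: add.commute intro!: T_sum in_T)
    finally show ?case .
  qed
  from this[of "length ys"] show ?thesis by (simp add: cl_lincomb_def lincomb_def)
qed

lemma W_eq: "W_mod m \<psi> = {cl_of m (lincomb c basis) | c. True}"
  by (simp add: W_mod_def cl_span_def X_list_eq cl_lincomb_eq T_basis)

lemma acts_by_is_matrix:
  assumes "acts_by g basis M" "g \<in> T" "\<psi> h = cl_of m g"
  shows "is_matrix_wrt m (X_list m \<psi>) (cl_act m \<psi> h) M"
  unfolding is_matrix_wrt_def X_list_eq
proof (intro conjI allI impI)
  show "M \<in> carrier_mat (length (map (cl_of m) basis)) (length (map (cl_of m) basis))"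
    using assms(1) by (simp add: acts_by_def)
  fix i assume i: "i < length (map (cl_of m) basis)"
  then have "basis ! i \<in> T" using T_basis by auto
  then have "cl_of m (basis ! i) \<otimes>\<^bsub>Cl m\<^esub> cl_of m g = cl_of m (basis ! i * g)"
    using assms(2) by (simp add: cl_of_mult)
  with i assms(1,3) show "cl_act m \<psi> h (map (cl_of m) basis ! i) =
      cl_lincomb m (\<lambda>j. M $$ (i, j)) (map (cl_of m) basis)"
    by (simp add: cl_lincomb_eq T_basis acts_by_def cong_def cl_act_def)
qed

lemma acts_by_lincomb:
  assumes "acts_by g ys M"
  shows "lincomb c ys * g \<simeq>\<^sub>C lincomb (\<lambda>j. \<Sum>i<length ys. c i * M $$ (i, j)) ys"
proof -
  have tscal_sum: "tscal (sum f S) = (\<Sum>i\<in>S. tscal (f i))" for f :: "nat \<Rightarrow> coeff_ring" and S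
    by (induction S rule: infinite_finite_induct) (simp_all add: tscal_simps)
  have "lincomb c ys * g = (\<Sum>i<length ys. tscal (c i) * (ys ! i * g))"
    by (simp add: lincomb_def sum_distrib_right mult.assoc)
  also have "\<dots> \<simeq>\<^sub>C (\<Sum>i<length ys. tscal (c i) * lincomb (\<lambda>j. M $$ (i, j)) ys)"
    using assms by (intro cong_sum cong_mult_left T_tscal) (simp add: acts_by_def)
  also have "\<dots> = (\<Sum>i<length ys. \<Sum>j<length ys. tscal (c i * M $$ (i, j)) * ys ! j)"
    by (simp add: lincomb_def sum_distrib_left tscal_simps mult.assoc)
  also have "\<dots> = lincomb (\<lambda>j. \<Sum>i<length ys. c i * M $$ (i, j)) ys"
    by (subst sum.swap) (simp add: lincomb_def tscal_sum sum_distrib_right)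
  finally show ?thesis .
qed

text \<open>A submonoid of the Clifford algebra, so it suffices to check invariance on letters.\<close>

definition stabilizer :: "cliff set" where
  "stabilizer = {z \<in> carrier (Cl m). \<forall>x \<in> W_mod m \<psi>. x \<otimes>\<^bsub>Cl m\<^esub> z \<in> W_mod m \<psi>}"

lemma W_carrier: "W_mod m \<psi> \<subseteq> carrier (Cl m)"
  using lincomb_closed[OF T_basis] by (auto simp: W_eq intro: CH.hom_closed)

lemma stabilizer_one: "\<one>\<^bsub>Cl m\<^esub> \<in> stabilizer"
  using W_carrier by (auto simp: stabilizer_def)

lemma stabilizer_mult:
  "y \<in> stabilizer \<Longrightarrow> z \<in> stabilizer \<Longrightarrow> y \<otimes>\<^bsub>Cl m\<^esub> z \<in> stabilizer"
  using W_carrier by (auto simp: stabilizer_def CH.S.m_assoc[symmetric] subset_iff)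

lemma acts_by_stabilizer:
  assumes "acts_by g basis M" "g \<in> T"
  shows "cl_of m g \<in> stabilizer"
proof -
  have "cl_of m (lincomb c basis) \<otimes>\<^bsub>Cl m\<^esub> cl_of m g \<in> W_mod m \<psi>" for c
    using acts_by_lincomb[OF assms(1), of c] assms(2)
    by (auto simp: W_eq cong_def cl_of_mult[symmetric] lincomb_closed[OF T_basis])
  then show ?thesis using assms(2) by (auto simp: stabilizer_def W_eq cl_carrier_iff)
qed

lemma a_acts_basis: "acts_by t_a basis (sidki_a m)" "\<exists>N. acts_by t_ainv basis N"
proof -
  have "m - 2 + 2 = m" "1 \<le> m - 2" using m_ge by auto
  then show "acts_by t_a basis (sidki_a m)" "\<exists>N. acts_by t_ainv basis N"
    using a_acts[of "m - 2"] by auto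
qed

lemma sig_acts_basis:
  assumes "1 \<le> i" "i < m"
  shows "acts_by (t_sig i) basis (sidki_s m i)"
proof (cases "i = 1")
  case True
  then show ?thesis using sig1_acts by simp
next
  case False
  have "m - 2 + 2 = m" "i + (m - 2) + 2 - m = i" "1 \<le> m - 2" "m - (m - 2) \<le> i"
    using False assms m_ge by auto
  then show ?thesis using sig_acts[of "m - 2" i] assms by simp
qed

text \<open>The multiplication table of the symmetric group, which is part of the presentation, reduces
  the letters for permutations to adjacent transpositions.\<close>

lemma psi_adj_transps:
  assumes "\<forall>i \<in> set is. 1 \<le> i \<and> i < m"
  shows "\<psi> (cls (gw_perm (apply_adj_transps is))) \<in> stabilizer"
  using assms
proof (induction "is")
  case Nil
  show ?case by (simp only: apply_adj_transps_Nil psi_perm_id stabilizer_one)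
next
  case (Cons i "is")
  have "\<psi> (cls (gw_perm (transpose i (i + 1)))) = cl_of m (t_sig i)"
    using psi_s[of i] Cons.prems by (simp add: y_s_def gw_s_def adj_transp_def)
  moreover have "cl_of m (t_sig i) \<in> stabilizer"
    using Cons.prems sig_acts_basis[of i] by (intro acts_by_stabilizer T_elems) auto
  moreover have "\<psi> (cls (gw_perm (apply_adj_transps (i # is)))) =
      \<psi> (cls (gw_perm (transpose i (i + 1)))) \<otimes>\<^bsub>Cl m\<^esub> \<psi> (cls (gw_perm (apply_adj_transps is)))"
    unfolding apply_adj_transps_Cons using Cons.prems
    by (intro psi_perm_comp permutes_apply_adj_transps permutes_swap_id) auto
  moreover have "\<psi> (cls (gw_perm (apply_adj_transps is))) \<in> stabilizer"
    using Cons by simp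
  ultimately show ?case by (simp only: stabilizer_mult)
qed

lemma psi_transpose:
  assumes "a \<in> {1..m}" "b \<in> {1..m}" "a < b"
  shows "\<psi> (cls (gw_perm (transpose a b))) \<in> stabilizer"
  using psi_adj_transps[of "adj_transp_seq a b"] assms
  by (simp add: adj_transp_seq_correct set_adj_transp_seq)

lemma psi_perm:
  assumes "p permutes {1..m}"
  shows "\<psi> (cls (gw_perm p)) \<in> stabilizer"
  using assms finite_atLeastAtMost[of 1 m]
proof (induction rule: permutes_induct)
  case id
  show ?case by (simp only: psi_perm_id stabilizer_one)
next
  case (swap a b p)
  then have "\<psi> (cls (gw_perm (transpose a b))) \<in> stabilizer"
    using psi_transpose[of a b] psi_transpose[of b a] by (cases "a < b") (auto simp: transpose_commute)
  moreover have "transpose a b permutes {1..m}" using swap by (intro permutes_swap_id)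
  ultimately show ?case using swap by (simp only: psi_perm_comp stabilizer_mult)
qed

lemma psi_letter:
  assumes "x \<in> y_gens m"
  shows "\<psi> (cls [(b, x)]) \<in> stabilizer"
proof -
  from assms consider "x = Gen_a" | p where "x = Gen_perm p" "p permutes {1..m}"
    by (auto simp: y_gens_def sym_group_carrier)
  then show ?thesis
  proof cases
    case 1
    have pos: "\<psi> (cls [(True, Gen_a)]) = cl_of m t_a"
      using psi_a by (simp add: y_a_def gw_a_def)
    have "cl_of m t_a \<otimes>\<^bsub>Cl m\<^esub> cl_of m t_ainv = \<one>\<^bsub>Cl m\<^esub>"
      using a_ainv(1) by (simp add: cong_def cl_of_mult[symmetric] T_elems cl_of_1)
    then have neg: "\<psi> (cls [(False, Gen_a)]) = cl_of m t_ainv"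
      using assms 1 pos by (intro psi_inverse_letter) (auto simp: cl_carrier_iff intro: T_elems)
    from a_acts_basis show ?thesis
      unfolding 1 by (cases b) (auto simp: pos neg intro: acts_by_stabilizer T_elems)
  next
    case 2
    note p = 2(2) and p' = permutes_inv[OF 2(2)]
    have "\<psi> (cls (gw_perm p)) \<otimes>\<^bsub>Cl m\<^esub> \<psi> (cls (gw_perm (inv_into UNIV p))) = \<one>\<^bsub>Cl m\<^esub>"
      using psi_perm_comp[OF p p'] permutes_inv_o(1)[OF p] psi_perm_id by simp
    then have "\<psi> (cls [(False, x)]) = \<psi> (cls (gw_perm (inv_into UNIV p)))"
      using assms psi_unit(2)[OF gens_perm[OF p']] 2(1)
      by (intro psi_inverse_letter) (auto simp: gw_perm_def)
    then show ?thesis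
      using psi_perm[OF p] psi_perm[OF p'] 2(1) by (cases b) (auto simp: gw_perm_def)
  qed
qed

lemma psi_word: "w \<in> gens \<Longrightarrow> \<psi> (cls w) \<in> stabilizer"
proof (induction w)
  case Nil
  then show ?case by (simp add: psi_Nil stabilizer_one)
next
  case (Cons l w)
  obtain b x where l: "l = (b, x)" by (cases l)
  with Cons.prems have x: "x \<in> y_gens m" and w: "w \<in> gens" by (auto simp: gwords_def)
  have "\<psi> (cls (l # w)) = \<psi> (cls [l]) \<otimes>\<^bsub>Cl m\<^esub> \<psi> (cls w)"
    using psi_append[OF gens_letter[OF x] w] l by simp
  then show ?case using psi_letter[OF x] Cons.IH[OF w] l by (simp add: stabilizer_mult)
qed

lemma W_invariant:
  assumes "g \<in> carrier (y_group m)" "x \<in> W_mod m \<psi>"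
  shows "cl_act m \<psi> g x \<in> W_mod m \<psi>"
  using assms psi_word
  by (auto simp: y_group_def pres_group_def cl_act_def stabilizer_def)

lemma X_list_independent: "cl_lin_indep m (X_list m \<psi>)"
  unfolding cl_lin_indep_def X_list_eq
proof (intro allI impI)
  fix c i
  assume "cl_lincomb m c (map (cl_of m) basis) = \<zero>\<^bsub>Cl m\<^esub>" and i: "i < length (map (cl_of m) basis)"
  then have "lincomb c basis \<simeq>\<^sub>C 0"
    by (simp add: cl_lincomb_eq T_basis cong_def lincomb_closed T_0 cl_of_0)
  then have "tensor_act m (lincomb c basis) vacuum = 0"
    using cong_tensor_act tensor_act_zero by metis
  then show "c i = 0" using i by (intro t_list_independent[of "m - 2" c i]) (auto simp: length_t_list)
qed

end

theorem proposition4p7: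
  fixes m :: nat and \<psi> :: "y_gen gword set \<Rightarrow> cliff"
  assumes m: "3 \<le> m"
    and psi: "is_psi m \<psi>"
  shows "cl_lin_indep m (X_list m \<psi>) \<and>
    (\<forall>g \<in> carrier (y_group m). \<forall>x \<in> W_mod m \<psi>. cl_act m \<psi> g x \<in> W_mod m \<psi>) \<and>
    is_matrix_wrt m (X_list m \<psi>) (cl_act m \<psi> (y_a m)) (sidki_a m) \<and>
    (\<forall>k \<in> {1..m-1}. is_matrix_wrt m (X_list m \<psi>) (cl_act m \<psi> (y_s m k)) (sidki_s m k))"
proof -
  interpret clifford_action m \<psi> by unfold_locales (fact m, fact psi)
  have "is_matrix_wrt m (X_list m \<psi>) (cl_act m \<psi> (y_s m k)) (sidki_s m k)" if "k \<in> {1..m-1}" for k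
    using that m_ge by (intro acts_by_is_matrix[OF sig_acts_basis] psi_s T_elems) auto
  moreover have "is_matrix_wrt m (X_list m \<psi>) (cl_act m \<psi> (y_a m)) (sidki_a m)"
    by (intro acts_by_is_matrix[OF a_acts_basis(1)] psi_a T_elems)
  ultimately show ?thesis using X_list_independent W_invariant by blast
qed

end
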